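(* Let $d\ge 1$, let $p=(p_1,\dots,p_d):\mathcal{S}_d\to\mathcal{S}_d$ be Borel measurable with $p_0:=1-\sum_{j=1}^d p_j$, let $\xi$ be a random variable with support in $[0,1]$, and let $\{Z_n\}_{n\ge 0}$ be the Markov chain in $\mathcal{S}_d$ defined, from an initial point $Z_0\in\mathcal{S}_d$, by $Z_{n+1}=(1-\xi_n)Z_n+\xi_n\Theta_n$ (see context). Assume that there exist $\delta\in(0,\frac{1}{2^d})$ and $s,t\in(\delta^{1/d},1-\delta^{1/d})$ with $s<t$ such that: (i) $\mathbb{P}(\xi<1-\delta)<1$; (ii) there is an $\varepsilon>0$ such that for any $1\le k\le d$ and any $0\le j_1<j_2<\dots<j_k\le d$, $$\inf_{z\in\mathcal{S}_d,\ z_{j_1}+\dots+z_{j_k}\le\delta}\ \sum_{l=1}^k p_{j_l}(z)\ge\varepsilon;$$ (iii) there is $c>0$ such that for all Borel sets $B\subset[s(1-t)^{d-1}-\delta,\,t]\cup[(1-t)^d-\delta,\,1-s]$, $$\mathbb{P}(\xi\in B)\ge c\,\lambda(B),$$ where $\lambda$ is the Lebesgue measure on $[0,1]$. Then the Markov chain $\{Z_n\}_{n\ge 0}$ converges in distribution as $n\to\infty$.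
   Context: The standard orthogonal simplex is $\mathcal{S}_d=\{(z_1,\dots,z_d)\in\mathbb{R}^d:\ z_1+\dots+z_d\le 1,\ z_j\ge 0,\ j=1,\dots,d\}$. For $z=(z_1,\dots,z_d)\in\mathcal{S}_d$ write $z_0:=1-z_1-\dots-z_d$. The vertices of $\mathcal{S}_d$ are $E_0=(0,\dots,0)$ and the standard basis vectors $E_1,\dots,E_d$ of $\mathbb{R}^d$. The chain: $Z_0\in\mathcal{S}_d$ is an initial point, and for $n=0,1,2,\dots$, $Z_{n+1}=(1-\xi_n)Z_n+\xi_n\Theta_n$, where $\xi_0,\xi_1,\dots$ are independent copies of $\xi$, with $\xi_n$ independent of $(Z_0,\dots,Z_n)$ and of $(\xi_k,\Theta_k)_{k<n}$, and $\Theta_n$ is a discrete random vector with values in $\{E_0,\dots,E_d\}$ such that $\mathbb{P}(\Theta_n=E_j\mid Z_0,\dots,Z_n;\xi_n)=p_j(Z_n)$ for $j=0,1,\dots,d$. *)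

theory Defs
  imports "HOL-Probability.Probability"
begin

text \<open>
  The dimension \<open>d \<ge> 1\<close> is \<open>CARD('n)\<close>. The index set \<open>{0, \<dots>, d}\<close> is
  represented by \<open>'n option\<close>, where \<open>None\<close> plays the role of the index \<open>0\<close>.
\<close>

definition orth_simplex :: "(real ^ 'n) set"
  where "orth_simplex = {z. (\<Sum>i\<in>UNIV. z $ i) \<le> 1 \<and> (\<forall>i. 0 \<le> z $ i)}"

fun bary :: "real ^ 'n \<Rightarrow> 'n option \<Rightarrow> real"
  where
    "bary z None = 1 - (\<Sum>i\<in>UNIV. z $ i)"
  | "bary z (Some i) = z $ i"

fun vertex :: "'n option \<Rightarrow> real ^ 'n"
  where
    "vertex None = 0"
  | "vertex (Some i) = axis i 1"

text \<open>
  The sequences \<open>Z\<close>, \<open>\<xi>s\<close>, \<open>\<Theta>\<close> live on \<open>M\<close>; the generic variable \<open>\<xi>\<close>, of which the \<open>\<xi>s n\<close>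
  are independent copies, may live on another space \<open>N\<close>. The initial state may be random; a
  deterministic initial point is the case of a constant \<open>Z 0\<close>. The values of \<open>p\<close> outside
  the simplex play no role, since \<open>Z n\<close> lies in the simplex almost surely
  when \<open>\<xi>\<close> lies in \<open>[0, 1]\<close> almost surely.

  Independence from the past is stated for generated \<open>\<sigma>\<close>-algebras because \<open>indep_var\<close>
  requires both random variables to have the same type.
\<close>

locale simplex_chain = prob_space M
  for M :: "'w measure"
    and N :: "'v measure"
    and \<xi> :: "'v \<Rightarrow> real"
    and p :: "real ^ 'n \<Rightarrow> real ^ 'n"
    and Z :: "nat \<Rightarrow> 'w \<Rightarrow> real ^ 'n"
    and \<xi>s :: "nat \<Rightarrow> 'w \<Rightarrow> real"
    and \<Theta> :: "nat \<Rightarrow> 'w \<Rightarrow> real ^ 'n" +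
  assumes initial_measurable: "Z 0 \<in> borel_measurable M"
    and initial_in_simplex: "\<And>\<omega>. \<omega> \<in> space M \<Longrightarrow> Z 0 \<omega> \<in> orth_simplex"
    and step: "\<And>n \<omega>. \<omega> \<in> space M \<Longrightarrow>
        Z (Suc n) \<omega> = (1 - \<xi>s n \<omega>) *\<^sub>R Z n \<omega> + \<xi>s n \<omega> *\<^sub>R \<Theta> n \<omega>"
    and copies_distr: "\<And>n. distr M borel (\<xi>s n) = distr N borel \<xi>"
    and copies_indep: "indep_vars (\<lambda>_. borel) \<xi>s UNIV"
    and copies_indep_past: "\<And>n. indep_set
        (sets (vimage_algebra (space M) (\<xi>s n) borel))
        (sets (vimage_algebra (space M)
          (\<lambda>\<omega>. (\<lambda>k\<in>{..n}. Z k \<omega>, \<lambda>k\<in>{..<n}. (\<xi>s k \<omega>, \<Theta> k \<omega>)))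
          ((\<Pi>\<^sub>M k\<in>{..n}. borel) \<Otimes>\<^sub>M (\<Pi>\<^sub>M k\<in>{..<n}. borel \<Otimes>\<^sub>M borel))))"
    and target_measurable: "\<And>n. \<Theta> n \<in> borel_measurable M"
    and target_vertex: "\<And>n \<omega>. \<omega> \<in> space M \<Longrightarrow> \<Theta> n \<omega> \<in> range vertex"
    and target_cond_prob: "\<And>n j. AE \<omega> in M.
        real_cond_exp M
          (vimage_algebra (space M) (\<lambda>\<omega>. (\<lambda>k\<in>{..n}. Z k \<omega>, \<xi>s n \<omega>))
            ((\<Pi>\<^sub>M k\<in>{..n}. borel) \<Otimes>\<^sub>M borel))
          (indicator {\<omega> \<in> space M. \<Theta> n \<omega> = vertex j}) \<omega>
        = bary (p (Z n \<omega>)) j"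

text \<open>
  The library's \<open>weak_conv_m\<close> is defined through distribution functions on the real line only.
\<close>

definition converges_in_distribution ::
    "'w measure \<Rightarrow> (nat \<Rightarrow> 'w \<Rightarrow> 'a::topological_space) \<Rightarrow> bool"
  where "converges_in_distribution M X \<longleftrightarrow>
    (\<exists>\<mu>. prob_space \<mu> \<and> sets \<mu> = sets borel \<and>
      (\<forall>f :: 'a \<Rightarrow> real. continuous_on UNIV f \<longrightarrow> bounded (range f) \<longrightarrow>
        (\<lambda>n. \<integral>\<omega>. f (X n \<omega>) \<partial>M) \<longlonglongrightarrow> (\<integral>x. f x \<partial>\<mu>)))"

end

theory Submission
  imports Defs
begin

text \<open>
  The chain satisfies a Doeblin condition: for some \<open>m\<close>, the law of \<open>Z\<^sub>m\<close> dominates, up to a positive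
  factor, one and the same measure for all starting points. Why this is so rests on the geometry of
  the jumps. A jump towards the vertex \<open>E\<^sub>j\<close> does not change the ratios among the barycentric
  coordinates other than the \<open>j\<close>-th. Hence, if the chain starts near \<open>E\<^sub>0\<close> and jumps to \<open>E\<^sub>1, \<dots>, E\<^sub>d\<close> in
  turn, each jump fixes one ratio once and for all, and the final position depends only on the
  numbers \<open>u\<^sub>k = z\<^sub>k / (z\<^sub>0 + \<dots> + z\<^sub>k)\<close> read off just after the jump to \<open>E\<^sub>k\<close>, not on the starting point
  (\<open>visit_proportional\<close>, \<open>visits_proportional\<close>).

  Along such a tour the coordinates of the unvisited vertices stay below \<open>\<delta>\<close> in total. Condition (ii)
  for sets with one element then says that the next vertex of the tour is targeted with probability
  at least \<open>\<epsilon>\<close>. Moreover the weight of the jump differs from \<open>u\<^sub>k\<close> by at most \<open>\<delta>\<close>, so that condition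
  (iii) gives \<open>u\<^sub>k\<close> a density bounded below on \<open>[s, t]\<close>. Together, \<open>d\<close> steps of the chain started near
  \<open>E\<^sub>0\<close> dominate a fixed iterated integral over the shares (\<open>T_pow_ge_visits\<close>).

  It remains to come near \<open>E\<^sub>0\<close> in a number of steps that does not depend on the starting point.
  Condition (i) provides jumps of weight at least \<open>1 - \<delta>\<close>, which end near their target. If \<open>d \<ge> 2\<close>,
  three of them suffice (\<open>contraction_higher_dim\<close>). If \<open>d = 1\<close>, one jump leads near one of the two
  endpoints, and the tours from the two endpoints dominate the same measure, by means of the second
  interval in condition (iii) and the reflection \<open>u \<mapsto> 1 - u\<close> (\<open>contraction_dim_one\<close>).

  The Doeblin condition makes the oscillation of \<open>z \<mapsto> P(Z\<^sub>n \<in> A | Z\<^sub>0 = z)\<close> decay geometrically, uniformly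
  in the Borel set \<open>A\<close> (\<open>oscillation_decay\<close>). By the Markov property, derived from the conditional
  target probabilities and the independence of the weights (\<open>expectation_step\<close>), the laws of \<open>Z\<^sub>n\<close>
  converge uniformly on Borel sets. The limit is a probability measure, and integrals of bounded
  measurable functions converge as well, in particular those of continuous ones.
\<close>

section \<open>Barycentric coordinates and jumps\<close>

lemma sum_UNIV_option: "(\<Sum>i\<in>UNIV. f i) = f None + (\<Sum>i\<in>UNIV. f (Some i))"
  for f :: "'n::finite option \<Rightarrow> real"
  by (simp add: UNIV_option_conv sum.reindex)

lemma sum_bary: "(\<Sum>i\<in>UNIV. bary z i) = 1"
  by (simp add: sum_UNIV_option)

lemma bary_eqI: "(\<And>i. bary z i = bary z' i) \<Longrightarrow> z = z'"
  by (metis bary.simps(2) vec_eq_iff)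

lemma orth_simplex_iff_bary: "z \<in> orth_simplex \<longleftrightarrow> (\<forall>i. 0 \<le> bary z i)"
proof
  assume z: "z \<in> orth_simplex"
  have "0 \<le> bary z i" for i by (cases i) (use z in \<open>auto simp: orth_simplex_def\<close>)
  then show "\<forall>i. 0 \<le> bary z i" ..
next
  assume z: "\<forall>i. 0 \<le> bary z i"
  have "0 \<le> z $ i" for i using z[rule_format, of "Some i"] by simp
  moreover have "(\<Sum>i\<in>UNIV. z $ i) \<le> 1" using z[rule_format, of None] by simp
  ultimately show "z \<in> orth_simplex" by (simp add: orth_simplex_def)
qed

lemma bary_vertex: "bary (vertex j) i = of_bool (i = j)"
  by (cases i; cases j) (auto simp: axis_def)

lemma inj_vertex: "inj vertex"
  by (rule injI) (metis bary_vertex of_bool_eq_iff)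

definition jump :: "'n::finite option \<Rightarrow> real \<Rightarrow> real ^ 'n \<Rightarrow> real ^ 'n"
  where "jump j x z = (1 - x) *\<^sub>R z + x *\<^sub>R vertex j"

lemma bary_jump: "bary (jump j x z) i = (1 - x) * bary z i + x * of_bool (i = j)"
proof -
  have "bary ((1 - x) *\<^sub>R z + x *\<^sub>R y) i = (1 - x) * bary z i + x * bary y i" for y
    by (cases i) (simp_all add: sum.distrib flip: sum_distrib_left, simp add: algebra_simps)
  then show ?thesis by (simp add: jump_def bary_vertex)
qed

lemma jump_in_simplex: "z \<in> orth_simplex \<Longrightarrow> 0 \<le> x \<Longrightarrow> x \<le> 1 \<Longrightarrow> jump j x z \<in> orth_simplex"
  by (simp add: orth_simplex_iff_bary bary_jump)

lemma borel_measurable_bary [measurable]: "(\<lambda>z. bary z i) \<in> borel_measurable borel"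
  by (cases i) simp_all

lemma orth_simplex_borel [measurable]: "(orth_simplex :: (real ^ 'n::finite) set) \<in> sets borel"
proof -
  have eq: "orth_simplex = {z :: real ^ 'n. \<forall>i. 0 \<le> bary z i}"
    by (auto simp: orth_simplex_iff_bary)
  show ?thesis unfolding eq by measurable
qed

lemma measurable_jump [measurable (raw)]:
  assumes "f \<in> borel_measurable M" "g \<in> borel_measurable M"
  shows "(\<lambda>v. jump j (f v) (g v)) \<in> borel_measurable M"
  unfolding jump_def using assms by measurable

section \<open>Visiting a vertex with a prescribed share\<close>

text \<open>
  A jump towards \<open>E\<^sub>j\<close> keeps all ratios of barycentric coordinates other than the \<open>j\<close>-th. If \<open>L\<close> is
  the set of vertices already visited, the natural parameter of the jump is therefore not the weight
  \<open>x\<close> itself but the share \<open>u\<close> that the coordinate \<open>j\<close> has, after the jump, in the total mass of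
  \<open>insert j L\<close>. Solving for \<open>x\<close> gives the following formula; what the parametrization achieves is
  stated in \<open>visit_ratio\<close>.
\<close>

definition visit_weight :: "'n::finite option set \<Rightarrow> 'n option \<Rightarrow> real \<Rightarrow> real ^ 'n \<Rightarrow> real"
  where "visit_weight L j u z =
    1 - (1 - u) / ((\<Sum>i\<in>L. bary z i) + (1 - u) * (\<Sum>i\<in>- insert j L. bary z i))"

definition visit :: "'n::finite option set \<Rightarrow> 'n option \<Rightarrow> real \<Rightarrow> real ^ 'n \<Rightarrow> real ^ 'n"
  where "visit L j u z = jump j (visit_weight L j u z) z"

lemma measurable_visit [measurable (raw)]:
  assumes [measurable]: "f \<in> borel_measurable M" "g \<in> borel_measurable M"
  shows "(\<lambda>v. visit L j (f v) (g v)) \<in> borel_measurable M"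
  unfolding visit_def visit_weight_def by measurable

lemma sum_bary_split:
  assumes "j \<notin> L"
  shows "(\<Sum>i\<in>L. bary z i) + bary z j + (\<Sum>i\<in>- insert j L. bary z i) = 1"
proof -
  have "(\<Sum>i\<in>UNIV. bary z i) = (\<Sum>i\<in>insert j L. bary z i) + (\<Sum>i\<in>- insert j L. bary z i)"
    by (metis Compl_eq_Diff_UNIV add.commute finite_class.finite_UNIV subset_UNIV sum.subset_diff)
  with assms show ?thesis by (simp add: sum_bary)
qed

lemma sum_bary_Compl: "(\<Sum>i\<in>- L. bary z i) = 1 - (\<Sum>i\<in>L. bary z i)"
proof -
  have "(\<Sum>i\<in>UNIV. bary z i) = (\<Sum>i\<in>L. bary z i) + (\<Sum>i\<in>- L. bary z i)"
    by (metis Compl_eq_Diff_UNIV add.commute finite_class.finite_UNIV subset_UNIV sum.subset_diff)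
  then show ?thesis by (simp add: sum_bary)
qed

lemma visit_ratio:
  assumes j: "j \<notin> L" and u: "u < 1" and z: "z \<in> orth_simplex"
    and C: "0 < (\<Sum>i\<in>L. bary z i)"
  shows "(1 - u) * bary (visit L j u z) j = u * (\<Sum>i\<in>L. bary (visit L j u z) i)"
proof -
  define C R where "C = (\<Sum>i\<in>L. bary z i)" and "R = (\<Sum>i\<in>- insert j L. bary z i)"
  define x where "x = visit_weight L j u z"
  have e: "bary z j = 1 - C - R" using sum_bary_split[OF j, of z] by (simp add: C_def R_def)
  have "0 \<le> R" using z by (auto simp: R_def orth_simplex_iff_bary intro!: sum_nonneg)
  then have D: "0 < C + (1 - u) * R" using C u by (simp add: C_def add_pos_nonneg)
  have x: "(1 - x) * (C + (1 - u) * R) = 1 - u"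
    using D by (simp add: x_def visit_weight_def C_def R_def)
  have "(\<Sum>i\<in>L. bary (visit L j u z) i) = (\<Sum>i\<in>L. (1 - x) * bary z i)"
    by (intro sum.cong) (use j in \<open>auto simp: visit_def bary_jump x_def\<close>)
  also have "\<dots> = (1 - x) * C" by (simp add: C_def sum_distrib_left)
  finally have 1: "(\<Sum>i\<in>L. bary (visit L j u z) i) = (1 - x) * C" .
  have 2: "bary (visit L j u z) j = (1 - x) * (1 - C - R) + x"
    by (simp add: visit_def bary_jump e x_def)
  show ?thesis unfolding 1 2 using x by algebra
qed

text \<open>
  The two bounds that link the share \<open>u\<close> with the jump weight: as long as the unvisited vertices
  together carry mass at most \<open>\<delta>\<close>, the weight lies within \<open>\<delta>\<close> below \<open>u\<close>. So shares in \<open>[s, t]\<close> come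
  from weights in \<open>[s - \<delta>, t]\<close>, where the law of the weight has a density bounded below.
\<close>

lemma visit_formula_bounds:
  fixes C R u \<delta> :: real
  assumes "0 \<le> R" "C + R \<le> 1" "1 - \<delta> \<le> C" "0 < C" "0 \<le> \<delta>" "\<delta> \<le> u" "u < 1"
  shows "u - \<delta> \<le> 1 - (1 - u) / (C + (1 - u) * R)" and "1 - (1 - u) / (C + (1 - u) * R) \<le> u"
proof -
  define D where "D = C + (1 - u) * R"
  have "(1 - u) * R \<le> 1 * R" using assms by (intro mult_right_mono) auto
  then have D1: "D \<le> 1" using assms by (simp add: D_def)
  have DC: "C \<le> D" using assms by (simp add: D_def)
  have D0: "0 < D" using DC assms by simp
  have "(1 - u) / 1 \<le> (1 - u) / D" using D0 D1 assms by (intro divide_left_mono) auto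
  then show "1 - (1 - u) / (C + (1 - u) * R) \<le> u" by (simp add: D_def)
  have "1 - u \<le> (1 - u) + \<delta> * (u - \<delta>)" using assms by simp
  also have "\<dots> = (1 - u + \<delta>) * (1 - \<delta>)" by (simp add: algebra_simps)
  also have "\<dots> \<le> (1 - u + \<delta>) * D" using assms DC by (intro mult_left_mono) auto
  finally have "(1 - u) / D \<le> 1 - u + \<delta>" using D0 by (simp add: field_simps)
  then show "u - \<delta> \<le> 1 - (1 - u) / (C + (1 - u) * R)" by (simp add: D_def)
qed

definition near :: "real \<Rightarrow> 'n::finite option \<Rightarrow> (real ^ 'n) set"
  where "near \<delta> j = {z \<in> orth_simplex. 1 - \<delta> \<le> bary z j}"

text \<open>
  The smallness of the unvisited coordinates survives a visit, since a jump multiplies each of them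
  by \<open>1 - x \<le> 1\<close>. This is what allows the tour to continue.
\<close>

lemma visit_near_face:
  assumes z: "z \<in> orth_simplex" and L: "1 - \<delta> \<le> (\<Sum>i\<in>L. bary z i)" and j: "j \<notin> L"
    and "0 \<le> \<delta>" "\<delta> < 1" "\<delta> \<le> u" "u < 1"
  shows "u - \<delta> \<le> visit_weight L j u z" "visit_weight L j u z \<le> u"
    and "visit L j u z \<in> orth_simplex"
    and "1 - \<delta> \<le> (\<Sum>i\<in>insert j L. bary (visit L j u z) i)"
proof -
  have R: "0 \<le> (\<Sum>i\<in>- insert j L. bary z i)" "0 \<le> bary z j"
    using z by (auto simp: orth_simplex_iff_bary intro!: sum_nonneg)
  show a: "u - \<delta> \<le> visit_weight L j u z" and b: "visit_weight L j u z \<le> u"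
    unfolding visit_weight_def
    using sum_bary_split[OF j, of z] R assms by (intro visit_formula_bounds; simp)+
  show "visit L j u z \<in> orth_simplex"
    unfolding visit_def using a b assms by (intro jump_in_simplex) auto
  define x where "x = visit_weight L j u z"
  have "(\<Sum>i\<in>- insert j L. bary (visit L j u z) i) = (1 - x) * (\<Sum>i\<in>- insert j L. bary z i)"
    unfolding sum_distrib_left by (intro sum.cong) (auto simp: visit_def bary_jump x_def)
  also have "\<dots> \<le> 1 * (\<Sum>i\<in>- insert j L. bary z i)"
    using a assms R by (intro mult_right_mono) (auto simp: x_def)
  also have "\<dots> \<le> \<delta>" using sum_bary_split[OF j, of z] R L by simp
  finally show "1 - \<delta> \<le> (\<Sum>i\<in>insert j L. bary (visit L j u z) i)"
    by (simp add: sum_bary_Compl)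
qed

text \<open>
  Two points that agree on \<open>L\<close> up to a factor agree on \<open>insert j L\<close> up to a factor after visiting
  \<open>j\<close> with the same share: the ratios inside \<open>L\<close> are untouched, and the ratio of \<open>j\<close> to \<open>L\<close> is
  dictated by \<open>u\<close>. Thus one visit erases the dependence of the position on one more coordinate.
\<close>

lemma visit_proportional:
  assumes z: "z \<in> orth_simplex" "0 < (\<Sum>i\<in>L. bary z i)"
    and z': "z' \<in> orth_simplex" "0 < (\<Sum>i\<in>L. bary z' i)"
    and j: "j \<notin> L" and u: "u < 1"
    and ratio: "\<forall>i\<in>L. bary z i = c * bary z' i" and c: "0 < c"
  shows "\<exists>c'>0. \<forall>i\<in>insert j L. bary (visit L j u z) i = c' * bary (visit L j u z') i"
proof -
  define x x' where "x = visit_weight L j u z" and "x' = visit_weight L j u z'"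
  have pos: "0 < 1 - visit_weight L j u y" if "y \<in> orth_simplex" "0 < (\<Sum>i\<in>L. bary y i)" for y
  proof -
    have "0 \<le> (\<Sum>i\<in>- insert j L. bary y i)"
      using that by (auto simp: orth_simplex_iff_bary intro!: sum_nonneg)
    then show ?thesis using that u by (simp add: visit_weight_def add_pos_nonneg)
  qed
  have x: "0 < 1 - x" "0 < 1 - x'" using pos[OF z] pos[OF z'] by (auto simp: x_def x'_def)
  define c' where "c' = c * (1 - x) / (1 - x')"
  \<comment> \<open>On \<open>L\<close> both jumps only rescale, by \<open>1 - x\<close> and \<open>1 - x'\<close>.\<close>
  have L: "bary (visit L j u z) i = c' * bary (visit L j u z') i" if i: "i \<in> L" for i
  proof -
    have "i \<noteq> j" using i j by auto
    then show ?thesis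
      using x ratio i by (simp add: visit_def bary_jump c'_def x_def[symmetric] x'_def[symmetric])
  qed
  have "(1 - u) * bary (visit L j u z) j = u * (\<Sum>i\<in>L. bary (visit L j u z) i)"
    by (rule visit_ratio[OF j u z])
  also have "\<dots> = c' * (u * (\<Sum>i\<in>L. bary (visit L j u z') i))"
    using L by (simp add: sum_distrib_left mult_ac cong: sum.cong)
  also have "u * (\<Sum>i\<in>L. bary (visit L j u z') i) = (1 - u) * bary (visit L j u z') j"
    by (rule visit_ratio[OF j u z', symmetric])
  finally have "bary (visit L j u z) j = c' * bary (visit L j u z') j" using u by simp
  moreover have "0 < c'" using x c by (simp add: c'_def)
  ultimately show ?thesis using L by auto
qed

lemma integrable_indicator_bounded:
  fixes k :: "real \<Rightarrow> real"
  assumes "k \<in> borel_measurable borel" "\<And>x. \<bar>k x\<bar> \<le> B"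
  shows "integrable lborel (\<lambda>x. indicator {l..r} x * k x)"
proof (rule Bochner_Integration.integrable_bound)
  show "integrable lborel (\<lambda>x. B * indicator {l..r} x)"
    by (intro integrable_mult_right integrable_real_indicator)
      (simp_all add: emeasure_lborel_Icc_eq)
  show "(\<lambda>x. indicator {l..r} x * k x) \<in> borel_measurable lborel" using assms(1) by simp
  have "\<bar>k x\<bar> \<le> \<bar>B\<bar>" for x using assms(2)[of x] by simp
  then show "AE x in lborel. norm (indicator {l..r} x * k x) \<le> norm (B * indicator {l..r} x)"
    by (simp add: indicator_def)
qed

text \<open>
  The change of variables from weight to share. The map \<open>u \<mapsto> x\<close> has derivative
  \<open>C / (C + (1 - u) R)\<^sup>2 \<ge> C \<ge> 1/2\<close>, because \<open>C + (1 - u) R \<le> C + R \<le> 1\<close>.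
\<close>

lemma visit_substitution:
  fixes h :: "real \<Rightarrow> real"
  assumes h: "h \<in> borel_measurable borel" "\<And>x. 0 \<le> h x" "\<And>x. h x \<le> B"
    and CR: "0 \<le> R" "C + R \<le> 1" "1 - \<delta> \<le> C" "1/2 \<le> C"
    and ab: "0 \<le> \<delta>" "\<delta> \<le> a" "a \<le> b" "b < 1"
  shows "(\<integral>u. indicator {a..b} u * h (1 - (1 - u) / (C + (1 - u) * R)) \<partial>lborel)
    \<le> 2 * (\<integral>x. indicator {a - \<delta>..b} x * h x \<partial>lborel)"
proof -
  define g where "g u = 1 - (1 - u) / (C + (1 - u) * R)" for u
  define g' where "g' u = C / (C + (1 - u) * R)\<^sup>2" for u
  have D: "0 < C + (1 - u) * R" "C + (1 - u) * R \<le> 1" if "u \<in> {a..b}" for u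
  proof -
    show "0 < C + (1 - u) * R" using CR ab that by (simp add: add_pos_nonneg)
    have "(1 - u) * R \<le> 1 * R" using CR ab that by (intro mult_right_mono) auto
    then show "C + (1 - u) * R \<le> 1" using CR by simp
  qed
  note [measurable] = h(1)
  have [measurable]: "g \<in> borel_measurable borel" unfolding g_def by measurable
  have deriv: "(g has_real_derivative g' u) (at u)" if "u \<in> {a..b}" for u
  proof -
    have "C + (1 - u) * R \<noteq> 0" using D[OF that] by simp
    then show ?thesis
      unfolding g_def
      by (auto intro!: derivative_eq_intros simp: g'_def power2_eq_square algebra_simps)
  qed
  have g'_ge: "1/2 \<le> g' u" if "u \<in> {a..b}" for u
  proof -
    have "(C + (1 - u) * R)\<^sup>2 \<le> 1" using D[OF that] by (simp add: power_le_one)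
    moreover have "0 < (C + (1 - u) * R)\<^sup>2" using D[OF that] by simp
    ultimately have "C / 1 \<le> g' u" unfolding g'_def using CR by (intro divide_left_mono) auto
    then show ?thesis using CR by simp
  qed
  have cont: "continuous_on {a..b} g'"
    unfolding g'_def using D by (intro continuous_intros) force
  have sub: "(\<integral>\<^sup>+x. ennreal (h x * indicator {g a..g b} x) \<partial>lborel)
      = (\<integral>\<^sup>+u. ennreal (h (g u) * g' u * indicator {a..b} u) \<partial>lborel)"
  proof (rule nn_integral_substitution)
    show "set_borel_measurable borel {g a..g b} h"
      unfolding set_borel_measurable_def by measurable
    show "0 \<le> g' x" if "x \<in> {a..b}" for x using g'_ge[OF that] by simp
  qed (use deriv cont ab in auto)
  have ga: "a - \<delta> \<le> g a" "g b \<le> b"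
    unfolding g_def using CR ab by (auto intro!: visit_formula_bounds)
  have "ennreal (\<integral>u. indicator {a..b} u * h (g u) \<partial>lborel)
      = (\<integral>\<^sup>+u. ennreal (indicator {a..b} u * h (g u)) \<partial>lborel)"
    using h by (intro nn_integral_eq_integral[symmetric] integrable_indicator_bounded[where B=B]) auto
  also have "\<dots> \<le> (\<integral>\<^sup>+u. ennreal 2 * ennreal (h (g u) * g' u * indicator {a..b} u) \<partial>lborel)"
  proof (rule nn_integral_mono)
    fix u
    have "h (g u) \<le> 2 * (h (g u) * g' u)" if "u \<in> {a..b}"
      using mult_left_mono[OF g'_ge[OF that] h(2)[of "g u"]] by simp
    then show "ennreal (indicator {a..b} u * h (g u))
        \<le> ennreal 2 * ennreal (h (g u) * g' u * indicator {a..b} u)"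
      by (auto simp: indicator_def ennreal_mult'[symmetric] simp del: ennreal_numeral intro!: ennreal_leI)
  qed
  also have "\<dots> = ennreal 2 * (\<integral>\<^sup>+u. ennreal (h (g u) * g' u * indicator {a..b} u) \<partial>lborel)"
    unfolding g'_def by (intro nn_integral_cmult) measurable
  also have "\<dots> = ennreal 2 * (\<integral>\<^sup>+x. ennreal (h x * indicator {g a..g b} x) \<partial>lborel)"
    by (simp only: sub)
  also have "\<dots> \<le> ennreal 2 * (\<integral>\<^sup>+x. ennreal (indicator {a - \<delta>..b} x * h x) \<partial>lborel)"
    using ga h(2) by (intro mult_left_mono nn_integral_mono) (auto simp: indicator_def)
  also have "\<dots> = ennreal 2 * ennreal (\<integral>x. indicator {a - \<delta>..b} x * h x \<partial>lborel)"
    using h by (subst nn_integral_eq_integral) (auto intro!: integrable_indicator_bounded[where B=B])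
  also have "\<dots> = ennreal (2 * (\<integral>x. indicator {a - \<delta>..b} x * h x \<partial>lborel))"
    by (simp add: ennreal_mult')
  finally show ?thesis
    using h(2) by (subst (asm) ennreal_le_iff) (auto simp: g_def intro!: integral_nonneg_AE)
qed

section \<open>The transition operator and its oscillation\<close>

text \<open>
  The test functions are bounded and Borel measurable rather than continuous: \<open>p\<close> is only measurable,
  so the transition operator need not preserve continuity.
\<close>

definition bounded_borel :: "('a::topological_space \<Rightarrow> real) \<Rightarrow> bool"
  where "bounded_borel f \<longleftrightarrow> f \<in> borel_measurable borel \<and> (\<exists>B. \<forall>z. \<bar>f z\<bar> \<le> B)"

lemma bounded_borelI: "f \<in> borel_measurable borel \<Longrightarrow> (\<And>z. \<bar>f z\<bar> \<le> B) \<Longrightarrow> bounded_borel f"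
  by (auto simp: bounded_borel_def)

lemma bounded_borelE:
  assumes "bounded_borel f"
  obtains B where "f \<in> borel_measurable borel" "\<And>z. \<bar>f z\<bar> \<le> B" "0 \<le> B"
proof -
  from assms obtain B where B: "f \<in> borel_measurable borel" "\<And>z. \<bar>f z\<bar> \<le> B"
    by (auto simp: bounded_borel_def)
  show ?thesis by (rule that[of "\<bar>B\<bar>"]) (use B in \<open>auto intro: order_trans[OF B(2)]\<close>)
qed

lemma bounded_borel_measurable: "bounded_borel f \<Longrightarrow> f \<in> borel_measurable borel"
  by (simp add: bounded_borel_def)

lemma bounded_borel_affine:
  assumes "bounded_borel f"
  shows "bounded_borel (\<lambda>z. a + b * f z)"
proof -
  obtain B where B: "f \<in> borel_measurable borel" "\<And>z. \<bar>f z\<bar> \<le> B" "0 \<le> B"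
    using assms by (rule bounded_borelE) blast
  have "\<bar>a + b * f z\<bar> \<le> \<bar>a\<bar> + \<bar>b\<bar> * B" for z
    using mult_left_mono[OF B(2)[of z], of "\<bar>b\<bar>"] abs_triangle_ineq[of a "b * f z"]
    by (simp add: abs_mult)
  then show ?thesis using B(1) by (intro bounded_borelI) auto
qed

lemma bounded_borel_comp:
  assumes "bounded_borel f" and [measurable]: "g \<in> borel_measurable borel"
  shows "bounded_borel (\<lambda>x. f (g x))"
  using assms(1) by (rule bounded_borelE) (auto intro!: bounded_borelI)

lemma (in prob_space) integrable_bounded_borel:
  assumes "bounded_borel f" and [measurable]: "X \<in> borel_measurable M"
  shows "integrable M (\<lambda>\<omega>. f (X \<omega>))"
  using assms(1)
proof (rule bounded_borelE)
  fix B assume [measurable]: "f \<in> borel_measurable borel" and "\<And>z. \<bar>f z\<bar> \<le> B"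
  then show ?thesis by (intro integrable_const_bound[where B=B]) auto
qed

text \<open>
  The hypothesis on \<open>B\<close> says that the measure dominates \<open>c\<close> times Lebesgue measure on \<open>[l, r]\<close>; the
  inequality passes from sets to nonnegative functions by monotonicity of the integral in the measure.
\<close>

lemma integral_lower_bound_by_density:
  fixes M :: "real measure" and k :: "real \<Rightarrow> real"
  assumes "prob_space M" and M: "sets M = sets borel" and c: "0 \<le> c"
    and dens: "\<And>B. B \<in> sets borel \<Longrightarrow> B \<subseteq> {l..r} \<Longrightarrow> c * measure lborel B \<le> measure M B"
    and k: "bounded_borel k" "\<And>x. 0 \<le> k x"
  shows "c * (\<integral>x. indicator {l..r} x * k x \<partial>lborel) \<le> (\<integral>x. k x \<partial>M)"
proof -
  interpret prob_space M by fact
  note [measurable_cong] = M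
  obtain B where B: "k \<in> borel_measurable borel" "\<And>x. \<bar>k x\<bar> \<le> B"
    using k(1) by (rule bounded_borelE) blast
  note [measurable] = B(1)
  let ?D = "density lborel (\<lambda>x. ennreal c * indicator {l..r} x)"
  have "?D \<le> M"
  proof (subst le_measure)
    show "sets ?D = sets M" by (simp add: M)
    show "\<forall>A\<in>sets ?D. emeasure ?D A \<le> emeasure M A"
    proof
      fix A assume "A \<in> sets ?D"
      then have A [measurable]: "A \<in> sets borel" by simp
      have fin: "emeasure lborel (A \<inter> {l..r}) \<noteq> \<infinity>"
      proof -
        have "emeasure lborel (A \<inter> {l..r}) \<le> emeasure lborel {l..r}"
          by (intro emeasure_mono) auto
        also have "\<dots> < \<infinity>" by (simp add: emeasure_lborel_Icc_eq)
        finally show ?thesis by simp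
      qed
      have "emeasure ?D A = (\<integral>\<^sup>+x. ennreal c * indicator (A \<inter> {l..r}) x \<partial>lborel)"
        by (subst emeasure_density) (auto intro!: nn_integral_cong simp: indicator_def)
      also have "\<dots> = ennreal c * emeasure lborel (A \<inter> {l..r})"
        by (subst nn_integral_cmult) auto
      also have "\<dots> = ennreal (c * measure lborel (A \<inter> {l..r}))"
        using fin c by (simp add: emeasure_eq_ennreal_measure ennreal_mult')
      also have "\<dots> \<le> ennreal (prob (A \<inter> {l..r}))"
        by (intro ennreal_leI dens) auto
      also have "\<dots> \<le> emeasure M A"
        unfolding emeasure_eq_measure by (intro ennreal_leI finite_measure_mono) (auto simp: M)
      finally show "emeasure ?D A \<le> emeasure M A" .
    qed
  qed
  then have "(\<integral>\<^sup>+x. ennreal (k x) \<partial>?D) \<le> (\<integral>\<^sup>+x. ennreal (k x) \<partial>M)"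
    by (intro nn_integral_mono_measure) (simp_all add: M)
  also have "(\<integral>\<^sup>+x. ennreal (k x) \<partial>?D)
      = (\<integral>\<^sup>+x. ennreal c * ennreal (indicator {l..r} x * k x) \<partial>lborel)"
    by (subst nn_integral_density) (auto intro!: nn_integral_cong simp: indicator_def)
  also have "\<dots> = ennreal c * ennreal (\<integral>x. indicator {l..r} x * k x \<partial>lborel)"
    using B k by (subst nn_integral_cmult, simp, subst nn_integral_eq_integral)
      (auto intro!: integrable_indicator_bounded[where B=B])
  also have "\<dots> = ennreal (c * (\<integral>x. indicator {l..r} x * k x \<partial>lborel))"
    using c by (simp add: ennreal_mult')
  also have "(\<integral>\<^sup>+x. ennreal (k x) \<partial>M) = ennreal (\<integral>x. k x \<partial>M)"
    using integrable_bounded_borel[OF k(1), of "\<lambda>x. x"] k(2) M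
    by (intro nn_integral_eq_integral) (auto simp: measurable_ident_sets)
  finally show ?thesis using k(2) by (subst (asm) ennreal_le_iff) auto
qed

text \<open>
  The one-step mechanism: from \<open>z\<close>, a vertex is drawn with probabilities \<open>w z\<close> and a weight is drawn
  from \<open>\<mu>\<close>. The probabilities are required at every point of the space, also outside the simplex, so
  that the transition operator below is globally positive and preserves constants.
\<close>

locale vertex_kernel = prob_space \<mu>
  for \<mu> :: "real measure" and w :: "real ^ 'n::finite \<Rightarrow> 'n option \<Rightarrow> real" +
  assumes sets_mu [measurable_cong]: "sets \<mu> = sets borel"
    and mu_unit: "AE x in \<mu>. x \<in> {0..1}"
    and w_measurable [measurable]: "\<And>j. (\<lambda>z. w z j) \<in> borel_measurable borel"
    and w_nonneg: "\<And>z j. 0 \<le> w z j"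
    and w_sum: "\<And>z. (\<Sum>j\<in>UNIV. w z j) = 1"
begin

text \<open>
  The transition operator \<open>f \<mapsto> (z \<mapsto> E f(Z\<^sub>1))\<close> for the chain started at \<open>z\<close>.
\<close>

definition T :: "(real ^ 'n \<Rightarrow> real) \<Rightarrow> real ^ 'n \<Rightarrow> real"
  where "T f z = (\<Sum>j\<in>UNIV. w z j * (\<integral>x. f (jump j x z) \<partial>\<mu>))"

lemma integrable_jump: "bounded_borel f \<Longrightarrow> integrable \<mu> (\<lambda>x. f (jump j x z))"
  by (rule integrable_bounded_borel) measurable

lemma T_affine:
  assumes "bounded_borel f"
  shows "T (\<lambda>z. a + b * f z) z = a + b * T f z"
proof -
  have "T (\<lambda>z. a + b * f z) z = (\<Sum>j\<in>UNIV. w z j * (a + b * (\<integral>x. f (jump j x z) \<partial>\<mu>)))"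
    unfolding T_def using integrable_jump[OF assms] by (simp add: prob_space)
  also have "\<dots> = a * (\<Sum>j\<in>UNIV. w z j) + b * T f z"
    unfolding T_def sum_distrib_left by (simp add: algebra_simps sum.distrib)
  finally show ?thesis by (simp add: w_sum)
qed

lemma T_mono:
  assumes "bounded_borel f" "bounded_borel g" "\<And>z. f z \<le> g z"
  shows "T f z \<le> T g z"
  unfolding T_def using assms
  by (intro sum_mono mult_left_mono integral_mono integrable_jump) (auto simp: w_nonneg)

lemma T_const: "T (\<lambda>z. a) z = a"
  by (simp add: T_def prob_space w_sum flip: sum_distrib_right)

lemma bounded_borel_const: "bounded_borel (\<lambda>z. a)"
  by (auto simp: bounded_borel_def)

lemma bounded_borel_T:
  assumes f: "bounded_borel f"
  shows "bounded_borel (T f)"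
  using f
proof (rule bounded_borelE)
  fix B assume [measurable]: "f \<in> borel_measurable borel" and B: "\<And>z. \<bar>f z\<bar> \<le> B"
  have "(\<lambda>z. \<integral>x. f (jump j x z) \<partial>\<mu>) \<in> borel_measurable borel" for j
    by (rule borel_measurable_lebesgue_integral) measurable
  then have "T f \<in> borel_measurable borel"
    unfolding T_def[abs_def] by measurable
  moreover have "\<bar>T f z\<bar> \<le> B" for z
  proof -
    have "T f z \<le> T (\<lambda>_. B) z" "T (\<lambda>_. - B) z \<le> T f z"
      using B by (intro T_mono f bounded_borel_const; simp add: abs_le_iff minus_le_iff)+
    then show ?thesis by (simp add: T_const abs_le_iff)
  qed
  ultimately show ?thesis by (rule bounded_borelI)
qed

lemma bounded_borel_T_pow: "bounded_borel f \<Longrightarrow> bounded_borel ((T ^^ n) f)"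
  by (induction n) (auto intro: bounded_borel_T)

lemma T_cong_simplex:
  assumes "\<And>z. z \<in> orth_simplex \<Longrightarrow> f z = g z" "z \<in> orth_simplex"
    and [measurable]: "f \<in> borel_measurable borel" "g \<in> borel_measurable borel"
  shows "T f z = T g z"
  unfolding T_def
proof (intro sum.cong refl arg_cong2[where f="(*)"] integral_cong_AE)
  show "AE x in \<mu>. f (jump j x z) = g (jump j x z)" for j
    using mu_unit by eventually_elim (use assms in \<open>auto intro: jump_in_simplex\<close>)
qed measurable

lemma T_pow_cong_simplex:
  assumes "\<And>z. z \<in> orth_simplex \<Longrightarrow> f z = g z" "bounded_borel f" "bounded_borel g"
  shows "z \<in> orth_simplex \<Longrightarrow> (T ^^ n) f z = (T ^^ n) g z"
proof (induction n arbitrary: z)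
  case (Suc n)
  show ?case
    using Suc assms by (auto intro!: T_cong_simplex bounded_borel_measurable bounded_borel_T_pow)
qed (use assms in simp)

lemma T_pow_affine:
  assumes "bounded_borel f"
  shows "(T ^^ n) (\<lambda>z. a + b * f z) = (\<lambda>z. a + b * (T ^^ n) f z)"
proof (induction n)
  case (Suc n)
  have "T (\<lambda>z. a + b * (T ^^ n) f z) = (\<lambda>z. a + b * T ((T ^^ n) f) z)"
    by (intro ext T_affine bounded_borel_T_pow assms)
  with Suc show ?case by simp
qed simp

lemma T_pow_nonneg:
  assumes "bounded_borel f" "\<And>z. 0 \<le> f z"
  shows "0 \<le> (T ^^ n) f z"
proof (induction n arbitrary: z)
  case (Suc n)
  have "T (\<lambda>_. 0) z \<le> T ((T ^^ n) f) z"
    by (intro T_mono bounded_borel_const bounded_borel_T_pow assms Suc)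
  then show ?case by (simp add: T_const)
qed (use assms in simp)

lemma T_ge_target:
  assumes "bounded_borel f" "\<And>z. 0 \<le> f z" "\<epsilon> \<le> w z j"
  shows "\<epsilon> * (\<integral>x. f (jump j x z) \<partial>\<mu>) \<le> T f z"
proof -
  have nn: "0 \<le> (\<integral>x. f (jump i x z) \<partial>\<mu>)" for i
    using assms by (intro integral_nonneg_AE) auto
  have "\<epsilon> * (\<integral>x. f (jump j x z) \<partial>\<mu>) \<le> w z j * (\<integral>x. f (jump j x z) \<partial>\<mu>)"
    using assms nn by (intro mult_right_mono) auto
  also have "\<dots> \<le> T f z"
    unfolding T_def using nn w_nonneg by (intro member_le_sum) auto
  finally show ?thesis .
qed

definition contracts :: "nat \<Rightarrow> real \<Rightarrow> bool"
  where "contracts m \<rho> \<longleftrightarrow> (\<forall>f z z'. bounded_borel f \<longrightarrow> (\<forall>z. 0 \<le> f z \<and> f z \<le> 1) \<longrightarrow>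
    z \<in> orth_simplex \<longrightarrow> z' \<in> orth_simplex \<longrightarrow> (T ^^ m) f z - (T ^^ m) f z' \<le> \<rho>)"

lemma contractsI:
  assumes "\<And>f z z'. bounded_borel f \<Longrightarrow> (\<And>z. 0 \<le> f z \<and> f z \<le> 1) \<Longrightarrow>
      z \<in> orth_simplex \<Longrightarrow> z' \<in> orth_simplex \<Longrightarrow> (T ^^ m) f z - (T ^^ m) f z' \<le> \<rho>"
  shows "contracts m \<rho>"
  using assms by (auto simp: contracts_def)

text \<open>
  The contraction can be iterated: \<open>T\<^sup>m\<^sup>k f\<close>, restricted to the simplex, is an affine image of a function
  with values in \<open>[0, 1]\<close> whose scaling factor is the oscillation bound \<open>\<rho>\<^sup>k\<close> obtained so far, and \<open>T\<close>
  commutes with affine maps of the values.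
\<close>

lemma oscillation_decay:
  assumes contr: "contracts m \<rho>"
    and \<rho>: "0 < \<rho>"
    and f: "bounded_borel f" "\<And>z. 0 \<le> f z \<and> f z \<le> 1"
  shows "z \<in> orth_simplex \<Longrightarrow> z' \<in> orth_simplex \<Longrightarrow>
    (T ^^ (m * k)) f z - (T ^^ (m * k)) f z' \<le> \<rho> ^ k"
proof (induction k arbitrary: z z')
  case 0
  have "f z \<le> 1" "0 \<le> f z'" using f(2) by auto
  then show ?case by simp
next
  case (Suc k)
  define g where "g = (T ^^ (m * k)) f"
  define r where "r = \<rho> ^ k"
  define a where "a = Inf (g ` orth_simplex)"
  define h where "h z = indicator orth_simplex z * ((g z - a) / r)" for z
  have r: "0 < r" using \<rho> by (simp add: r_def)
  have g: "bounded_borel g" unfolding g_def by (rule bounded_borel_T_pow[OF f(1)])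
  note [measurable] = bounded_borel_measurable[OF g]
  have osc: "g y - g y' \<le> r" if "y \<in> orth_simplex" "y' \<in> orth_simplex" for y y'
    unfolding g_def r_def by (rule Suc.IH[OF that])
  have "0 \<le> g y" for y unfolding g_def using f by (intro T_pow_nonneg) auto
  then have a_le: "a \<le> g y" if "y \<in> orth_simplex" for y
    unfolding a_def using that by (intro cInf_lower bdd_belowI[of _ 0]) auto
  have a_ge: "g y - r \<le> a" if "y \<in> orth_simplex" for y
    unfolding a_def using that osc[OF that] by (intro cInf_greatest) (auto simp: diff_le_eq add.commute)
  have h01: "0 \<le> h y \<and> h y \<le> 1" for y
    using a_le[of y] a_ge[of y] r by (auto simp: h_def indicator_def)
  have h: "bounded_borel h"
  proof (rule bounded_borelI)
    show "h \<in> borel_measurable borel" unfolding h_def by measurable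
    show "\<bar>h y\<bar> \<le> 1" for y using h01[of y] by auto
  qed
  have eq: "(T ^^ m) h y = - a / r + (1 / r) * (T ^^ m) g y" if "y \<in> orth_simplex" for y
  proof -
    have "(T ^^ m) h y = (T ^^ m) (\<lambda>z. - a / r + (1 / r) * g z) y"
      by (rule T_pow_cong_simplex[OF _ h bounded_borel_affine[OF g] that])
        (simp add: h_def diff_divide_distrib)
    then show ?thesis unfolding T_pow_affine[OF g] .
  qed
  have "(T ^^ m) h z - (T ^^ m) h z' \<le> \<rho>"
    using contr h h01 Suc.prems by (auto simp: contracts_def)
  then have "(T ^^ m) g z - (T ^^ m) g z' \<le> \<rho> * r"
    using r by (simp add: eq Suc.prems diff_divide_distrib[symmetric] pos_divide_le_eq)
  moreover have "(T ^^ m) g = (T ^^ (m * Suc k)) f"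
    by (simp add: g_def funpow_add)
  ultimately show ?case by (simp add: r_def)
qed

end

section \<open>Tours through the vertices\<close>

text \<open>
  The value of \<open>f\<close> at the end of a tour through the vertices \<open>js\<close>, integrated over all shares in
  \<open>[a, b]\<close>. It is the minorizing functional of the Doeblin argument; as iterated one-dimensional
  integrals suffice, no change of variables in several dimensions occurs.
\<close>

primrec visits :: "real \<Rightarrow> real \<Rightarrow> (real ^ 'n::finite \<Rightarrow> real) \<Rightarrow> 'n option list \<Rightarrow> 'n option set
    \<Rightarrow> real ^ 'n \<Rightarrow> real"
  where
    "visits a b f [] L z = f z"
  | "visits a b f (j # js) L z =
      (\<integral>u. indicator {a..b} u * visits a b f js (insert j L) (visit L j u z) \<partial>lborel)"

lemma bounded_borel_visits:
  assumes f: "bounded_borel f"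
  shows "bounded_borel (visits a b f js L)"
proof (induction js arbitrary: L)
  case (Cons j js)
  let ?g = "visits a b f js (insert j L)"
  obtain B where [measurable]: "?g \<in> borel_measurable borel" and B: "\<And>z. \<bar>?g z\<bar> \<le> B" and B0: "0 \<le> B"
    using Cons by (rule bounded_borelE) blast
  have "(\<lambda>z. \<integral>u. indicator {a..b} u * ?g (visit L j u z) \<partial>lborel) \<in> borel_measurable borel"
    by (rule lborel.borel_measurable_lebesgue_integral) measurable
  moreover have "\<bar>\<integral>u. indicator {a..b} u * ?g (visit L j u z) \<partial>lborel\<bar> \<le> B * measure lborel {a..b}" for z
  proof -
    have "\<bar>\<integral>u. indicator {a..b} u * ?g (visit L j u z) \<partial>lborel\<bar>
        \<le> (\<integral>u. \<bar>indicator {a..b} u * ?g (visit L j u z)\<bar> \<partial>lborel)"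
      by (rule integral_abs_bound)
    also have "\<dots> \<le> (\<integral>u. indicator {a..b} u * B \<partial>lborel)"
      using B B0 by (intro integral_mono integrable_abs integrable_indicator_bounded[where B=B])
        (auto simp: indicator_def)
    finally show ?thesis by (simp add: mult.commute)
  qed
  ultimately have "bounded_borel (\<lambda>z. \<integral>u. indicator {a..b} u * ?g (visit L j u z) \<partial>lborel)"
    by (rule bounded_borelI)
  then show ?case by simp
next
  case Nil
  have "visits a b f [] L = f" by (simp add: fun_eq_iff)
  with f show ?case by simp
qed

lemma integrable_visits:
  assumes "bounded_borel f"
  shows "integrable lborel (\<lambda>u. indicator {a..b} u * visits a' b' f js L' (visit L j u z))"
proof -
  have "bounded_borel (\<lambda>u. visits a' b' f js L' (visit L j u z))"
    by (rule bounded_borel_comp[OF bounded_borel_visits[OF assms]]) measurable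
  then show ?thesis
    by (rule bounded_borelE) (rule integrable_indicator_bounded)
qed

lemma visits_complement:
  assumes "bounded_borel f" "a \<le> b"
  shows "visits a b f js L z + visits a b (\<lambda>z. 1 - f z) js L z = (b - a) ^ length js"
proof (induction js arbitrary: L z)
  case (Cons j js)
  let ?v = "\<lambda>f u. visits a b f js (insert j L) (visit L j u z)"
  have c: "bounded_borel (\<lambda>z. 1 - f z)" using bounded_borel_affine[OF assms(1), of 1 "-1"] by simp
  have "visits a b f (j # js) L z + visits a b (\<lambda>z. 1 - f z) (j # js) L z
      = (\<integral>u. indicator {a..b} u * ?v f u + indicator {a..b} u * ?v (\<lambda>z. 1 - f z) u \<partial>lborel)"
    using integrable_visits[OF assms(1)] integrable_visits[OF c] by simp
  also have "\<dots> = (\<integral>u. indicator {a..b} u * (b - a) ^ length js \<partial>lborel)"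
    by (simp only: distrib_left[symmetric] Cons.IH)
  finally show ?case using assms(2) by simp
qed simp

text \<open>
  A complete tour forgets its starting point. Each visit adds a vertex to the set on which the two
  positions are proportional; once this is the set of all vertices, the factor is \<open>1\<close> because the
  barycentric coordinates sum to \<open>1\<close>.
\<close>

lemma visits_proportional:
  assumes "a \<le> b" "b < 1" "0 \<le> \<delta>" "\<delta> < 1" "\<delta> \<le> a"
  shows "distinct js \<Longrightarrow> set js = - L \<Longrightarrow> z \<in> orth_simplex \<Longrightarrow> z' \<in> orth_simplex \<Longrightarrow>
    1 - \<delta> \<le> (\<Sum>i\<in>L. bary z i) \<Longrightarrow> 1 - \<delta> \<le> (\<Sum>i\<in>L. bary z' i) \<Longrightarrow>
    0 < c \<Longrightarrow> \<forall>i\<in>L. bary z i = c * bary z' i \<Longrightarrow>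
    visits a b f js L z = visits a b f js L z'"
proof (induction js arbitrary: L z z' c)
  case Nil
  then have L: "L = UNIV" by auto
  have "(\<Sum>i\<in>UNIV. bary z i) = c * (\<Sum>i\<in>UNIV. bary z' i)"
    using Nil by (simp add: L sum_distrib_left)
  then have "c = 1" by (simp add: sum_bary)
  then have "z = z'" using Nil by (intro bary_eqI) (simp add: L)
  then show ?case by simp
next
  case (Cons j js)
  have j: "j \<notin> L" using Cons.prems by auto
  have js: "distinct js" "set js = - insert j L" using Cons.prems by auto
  have "visits a b f js (insert j L) (visit L j u z) = visits a b f js (insert j L) (visit L j u z')"
    if u: "u \<in> {a..b}" for u
  proof -
    have "0 < 1 - \<delta>" using assms by simp
    then have pos: "0 < (\<Sum>i\<in>L. bary z i)" "0 < (\<Sum>i\<in>L. bary z' i)" using Cons.prems by linarith+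
    obtain c' where "0 < c'" "\<forall>i\<in>insert j L. bary (visit L j u z) i = c' * bary (visit L j u z') i"
      using visit_proportional[OF Cons.prems(3) pos(1) Cons.prems(4) pos(2) j _ Cons.prems(8,7), of u] u assms by auto
    then show ?thesis
      using visit_near_face[OF Cons.prems(3,5) j, of u] visit_near_face[OF Cons.prems(4,6) j, of u] u assms
      by (intro Cons.IH[OF js]) auto
  qed
  then show ?case by (auto intro!: Bochner_Integration.integral_cong simp: indicator_def)
qed

context vertex_kernel
begin

text \<open>
  One step of the chain dominates one visit with a uniformly distributed share. Of all targets only
  \<open>j\<close> is kept, which costs \<open>\<epsilon>\<close>; replacing the law of the weight by Lebesgue measure costs \<open>c\<close>, and
  the substitution costs \<open>1/2\<close>.
\<close>

lemma T_ge_visit: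
  assumes h: "bounded_borel h" "\<And>z. 0 \<le> h z"
    and z: "z \<in> orth_simplex" "1 - \<delta> \<le> (\<Sum>i\<in>L. bary z i)" and j: "j \<notin> L" 
    and w: "\<epsilon> \<le> w z j" "0 \<le> \<epsilon>"
    and ab: "0 \<le> \<delta>" "\<delta> \<le> 1/2" "\<delta> \<le> a" "a \<le> b" "b < 1"
    and c: "0 \<le> c" and dens: "\<And>B. B \<in> sets borel \<Longrightarrow> B \<subseteq> {a - \<delta>..b} \<Longrightarrow> c * measure lborel B \<le> prob B"
  shows "\<epsilon> * c / 2 * (\<integral>u. indicator {a..b} u * h (visit L j u z) \<partial>lborel) \<le> T h z"
proof -
  let ?k = "\<lambda>x. h (jump j x z)"
  have k: "bounded_borel ?k" by (rule bounded_borel_comp[OF h(1)]) measurable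
  then obtain B where B: "?k \<in> borel_measurable borel" "\<And>x. \<bar>?k x\<bar> \<le> B"
    by (rule bounded_borelE) blast
  have R: "0 \<le> (\<Sum>i\<in>- insert j L. bary z i)" "0 \<le> bary z j"
    using z by (auto simp: orth_simplex_iff_bary intro!: sum_nonneg)
  have "(\<integral>u. indicator {a..b} u * h (visit L j u z) \<partial>lborel)
      \<le> 2 * (\<integral>x. indicator {a - \<delta>..b} x * ?k x \<partial>lborel)"
    unfolding visit_def visit_weight_def
    using B h(2) ab z R sum_bary_split[OF j, of z]
    by (intro visit_substitution[where B=B]) (auto simp: abs_le_iff)
  from mult_left_mono[OF this, of "\<epsilon> * c / 2"]
  have "\<epsilon> * c / 2 * (\<integral>u. indicator {a..b} u * h (visit L j u z) \<partial>lborel)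
      \<le> \<epsilon> * (c * (\<integral>x. indicator {a - \<delta>..b} x * ?k x \<partial>lborel))"
    using w c by simp
  also have "\<dots> \<le> \<epsilon> * (\<integral>x. ?k x \<partial>\<mu>)"
    using w dens h by (intro mult_left_mono integral_lower_bound_by_density[OF prob_space_axioms sets_mu c _ k]) auto
  also have "\<dots> \<le> T h z" by (rule T_ge_target[OF h w(1)])
  finally show ?thesis .
qed

text \<open>
  During the tour every vertex still to be visited has coordinate at most \<open>\<delta>\<close>, which is exactly the
  situation in which it is targeted with probability at least \<open>\<epsilon>\<close>. Hence the order of the visits
  can be prescribed.
\<close>

lemma T_pow_ge_visits:
  assumes f: "bounded_borel f" "\<And>z. 0 \<le> f z"
    and w: "\<And>z j. z \<in> orth_simplex \<Longrightarrow> bary z j \<le> \<delta> \<Longrightarrow> \<epsilon> \<le> w z j" "0 \<le> \<epsilon>"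
    and ab: "0 \<le> \<delta>" "\<delta> \<le> 1/2" "\<delta> \<le> a" "a \<le> b" "b < 1"
    and c: "0 \<le> c" and dens: "\<And>B. B \<in> sets borel \<Longrightarrow> B \<subseteq> {a - \<delta>..b} \<Longrightarrow> c * measure lborel B \<le> prob B"
  shows "distinct js \<Longrightarrow> set js \<subseteq> - L \<Longrightarrow> z \<in> orth_simplex \<Longrightarrow>
    1 - \<delta> \<le> (\<Sum>i\<in>L. bary z i) \<Longrightarrow>
    (\<epsilon> * c / 2) ^ length js * visits a b f js L z \<le> (T ^^ length js) f z"
proof (induction js arbitrary: L z)
  case (Cons j js)
  let ?n = "length js"
  let ?\<eta> = "\<epsilon> * c / 2"
  let ?h = "(T ^^ ?n) f"
  have j: "j \<notin> L" using Cons.prems by auto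
  have h: "bounded_borel ?h" by (rule bounded_borel_T_pow[OF f(1)])
  have "bary z j \<le> \<delta>"
  proof -
    have "bary z j \<le> (\<Sum>i\<in>- L. bary z i)"
      using j Cons.prems by (intro member_le_sum) (auto simp: orth_simplex_iff_bary)
    then show ?thesis using Cons.prems by (simp add: sum_bary_Compl)
  qed
  then have wz: "\<epsilon> \<le> w z j" using Cons.prems w by auto
  have "?\<eta> ^ ?n * visits a b f (j # js) L z
      = (\<integral>u. indicator {a..b} u * (?\<eta> ^ ?n * visits a b f js (insert j L) (visit L j u z)) \<partial>lborel)"
    unfolding mult.left_commute[of "indicator _ _"] by simp
  also have "\<dots> \<le> (\<integral>u. indicator {a..b} u * ?h (visit L j u z) \<partial>lborel)"
  proof (rule integral_mono)
    show "integrable lborel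
        (\<lambda>u. indicator {a..b} u * (?\<eta> ^ ?n * visits a b f js (insert j L) (visit L j u z)))"
      unfolding mult.left_commute[of "indicator _ _"]
      by (intro integrable_mult_right integrable_visits f)
    show "integrable lborel (\<lambda>u. indicator {a..b} u * ?h (visit L j u z))"
      using integrable_visits[OF h, of a b a b "[]"] by simp
    show "indicator {a..b} u * (?\<eta> ^ ?n * visits a b f js (insert j L) (visit L j u z))
        \<le> indicator {a..b} u * ?h (visit L j u z)" for u
    proof (cases "u \<in> {a..b}")
      case True
      then have "?\<eta> ^ ?n * visits a b f js (insert j L) (visit L j u z) \<le> ?h (visit L j u z)"
        using visit_near_face[OF Cons.prems(3,4) j, of u] ab Cons.prems(1,2)
        by (intro Cons.IH) auto
      with True show ?thesis by simp
    qed simp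
  qed
  finally have "?\<eta> * (?\<eta> ^ ?n * visits a b f (j # js) L z)
      \<le> ?\<eta> * (\<integral>u. indicator {a..b} u * ?h (visit L j u z) \<partial>lborel)"
    using w c by (intro mult_left_mono) auto
  also have "\<dots> \<le> T ?h z"
    using h T_pow_nonneg[OF f] Cons.prems(3,4) j wz w(2) ab c dens by (rule T_ge_visit)
  finally show ?case by (simp add: mult.assoc)
qed simp

text \<open>
  A jump of weight at least \<open>1 - \<delta>\<close> towards \<open>E\<^sub>j\<close> ends near \<open>E\<^sub>j\<close>, wherever it starts.
\<close>

lemma T_ge_near:
  assumes q: "q \<le> prob {1 - \<delta>..}" "0 \<le> q" "0 \<le> \<delta>" "\<delta> \<le> 1"
    and f: "bounded_borel f" "\<And>z. 0 \<le> f z"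
    and \<beta>: "0 \<le> \<beta>" "\<And>z. z \<in> near \<delta> j \<Longrightarrow> \<beta> \<le> f z"
    and z: "z \<in> orth_simplex" "\<epsilon> \<le> w z j" "0 \<le> \<epsilon>"
  shows "\<epsilon> * q * \<beta> \<le> T f z"
proof -
  have "q * \<beta> \<le> (\<integral>x. indicator {1 - \<delta>..} x * \<beta> \<partial>\<mu>)"
    using q \<beta> by (simp add: mult_right_mono)
  also have "\<dots> \<le> (\<integral>x. f (jump j x z) \<partial>\<mu>)"
  proof (rule integral_mono_AE)
    show "integrable \<mu> (\<lambda>x. indicator {1 - \<delta>..} x * \<beta>)"
      by (intro integrable_mult_left integrable_real_indicator) (auto simp: emeasure_eq_measure)
    show "AE x in \<mu>. indicator {1 - \<delta>..} x * \<beta> \<le> f (jump j x z)"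
      using mu_unit
    proof eventually_elim
      case (elim x)
      show ?case
      proof (cases "1 - \<delta> \<le> x")
        case True
        have "0 \<le> (1 - x) * bary z j" using elim z by (auto simp: orth_simplex_iff_bary)
        then have "jump j x z \<in> near \<delta> j"
          using True elim z by (auto simp: near_def bary_jump intro: jump_in_simplex)
        then show ?thesis using \<beta> True by simp
      qed (use f in simp)
    qed
  qed (rule integrable_jump[OF f(1)])
  finally have "\<epsilon> * (q * \<beta>) \<le> \<epsilon> * (\<integral>x. f (jump j x z) \<partial>\<mu>)" using z by (intro mult_left_mono) auto
  also have "\<dots> \<le> T f z" by (rule T_ge_target[OF f z(2)])
  finally show ?thesis by (simp add: mult.assoc)
qed

lemma ex_likely_target: "\<exists>j. 1 / (CARD('n) + 1) \<le> w z j"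
proof (rule ccontr)
  assume "\<not> ?thesis"
  then have "w z j < 1 / (CARD('n) + 1)" for j by (auto simp: not_le)
  then have "(\<Sum>j\<in>UNIV. w z j) < (\<Sum>j\<in>(UNIV :: 'n option set). 1 / (CARD('n) + 1))"
    by (intro sum_strict_mono) auto
  then show False by (simp add: w_sum card_UNIV_option)
qed

end

section \<open>Minorization and contraction\<close>

lemma visits_nonneg: "(\<And>z. 0 \<le> f z) \<Longrightarrow> 0 \<le> visits a b f js L z"
  by (induction js arbitrary: L z) (auto intro!: integral_nonneg_AE)

lemma visit_between_two:
  assumes "i \<noteq> j" "UNIV = {i, j}" and z: "z \<in> orth_simplex" "0 < bary z i" and u: "u < 1"
  shows "bary (visit {i} j u z) j = u" "bary (visit {i} j u z) i = 1 - u"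
proof -
  let ?y = "visit {i} j u z"
  have "(1 - u) * bary ?y j = u * bary ?y i"
    using visit_ratio[of j "{i}" u z] assms by simp
  moreover have "bary ?y i + bary ?y j = 1"
  proof -
    have "(\<Sum>l\<in>{i, j}. bary ?y l) = 1" using sum_bary[of ?y] unfolding assms(2) .
    then show ?thesis using \<open>i \<noteq> j\<close> by simp
  qed
  ultimately show "bary ?y j = u" "bary ?y i = 1 - u" by algebra+
qed

lemma near_bary_le:
  assumes "z \<in> near \<delta> i" "j \<noteq> i"
  shows "bary z j \<le> \<delta>"
proof -
  have "bary z j \<le> (\<Sum>l\<in>- {i}. bary z l)"
    using assms by (intro member_le_sum) (auto simp: orth_simplex_iff_bary near_def)
  then show ?thesis using assms by (simp add: sum_bary_Compl near_def)
qed

context vertex_kernel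
begin

text \<open>
  Doeblin's argument. If \<open>\<Lambda>\<close> bounds \<open>T\<^sup>m\<close> from below, apply this to \<open>f\<close> at \<open>z'\<close> and to \<open>1 - f\<close> at \<open>z\<close>:
  \<open>T\<^sup>m f z - T\<^sup>m f z' \<le> 1 - \<Lambda> (1 - f) - \<Lambda> f = 1 - \<theta>\<close>. The maximum with \<open>1/2\<close> in the proof only
  keeps the rate positive.
\<close>

lemma contraction_if_minorized:
  assumes lower: "\<And>f z. bounded_borel f \<Longrightarrow> (\<And>z. 0 \<le> f z) \<Longrightarrow> z \<in> orth_simplex \<Longrightarrow>
      \<Lambda> f \<le> (T ^^ m) f z"
    and mass: "\<And>f. bounded_borel f \<Longrightarrow> \<Lambda> f + \<Lambda> (\<lambda>z. 1 - f z) = \<theta>" and "0 < \<theta>"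
  shows "\<exists>\<rho>. 0 < \<rho> \<and> \<rho> < 1 \<and> contracts m \<rho>"
proof (intro exI[of _ "max (1/2) (1 - \<theta>)"] conjI contractsI)
  fix f :: "real ^ 'n \<Rightarrow> real" and z z' :: "real ^ 'n"
  assume f: "bounded_borel f" "\<And>z. 0 \<le> f z \<and> f z \<le> 1" and z: "z \<in> orth_simplex" "z' \<in> orth_simplex"
  have c: "bounded_borel (\<lambda>z. 1 - f z)" using bounded_borel_affine[OF f(1), of 1 "-1"] by simp
  have "\<Lambda> (\<lambda>z. 1 - f z) \<le> (T ^^ m) (\<lambda>z. 1 - f z) z" using f z by (intro lower c) auto
  also have "\<dots> = 1 - (T ^^ m) f z" using T_pow_affine[OF f(1), where a=1 and b="-1" and n=m] by simp
  finally have "\<Lambda> (\<lambda>z. 1 - f z) \<le> 1 - (T ^^ m) f z" .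
  moreover have "\<Lambda> f \<le> (T ^^ m) f z'" using f z by (intro lower) auto
  ultimately show "(T ^^ m) f z - (T ^^ m) f z' \<le> max (1/2) (1 - \<theta>)"
    using mass[OF f(1)] by simp
qed (use \<open>0 < \<theta>\<close> in auto)

lemma T_ge_anywhere:
  assumes q: "q \<le> prob {1 - \<delta>..}" "0 \<le> q" "0 \<le> \<delta>" "\<delta> \<le> 1"
    and f: "bounded_borel f" "\<And>z. 0 \<le> f z"
    and \<beta>: "0 \<le> \<beta>" "\<And>j z. z \<in> near \<delta> j \<Longrightarrow> \<beta> \<le> f z"
    and z: "z \<in> orth_simplex"
  shows "1 / (CARD('n) + 1) * q * \<beta> \<le> T f z"
proof -
  obtain j where "1 / (CARD('n) + 1) \<le> w z j" using ex_likely_target by blast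
  with assms show ?thesis by (intro T_ge_near[where j=j and \<delta>=\<delta>]) auto
qed

lemma T_ge_other_vertex:
  assumes q: "q \<le> prob {1 - \<delta>..}" "0 \<le> q" "0 \<le> \<delta>" "\<delta> \<le> 1"
    and w: "\<And>z j. z \<in> orth_simplex \<Longrightarrow> bary z j \<le> \<delta> \<Longrightarrow> \<epsilon> \<le> w z j" "0 \<le> \<epsilon>"
    and f: "bounded_borel f" "\<And>z. 0 \<le> f z"
    and \<beta>: "0 \<le> \<beta>" "\<And>z. z \<in> near \<delta> j \<Longrightarrow> \<beta> \<le> f z"
    and z: "z \<in> near \<delta> i" "j \<noteq> i"
  shows "\<epsilon> * q * \<beta> \<le> T f z"
proof (rule T_ge_near[OF q f \<beta>])
  show "z \<in> orth_simplex" using z by (simp add: near_def)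
  then show "\<epsilon> \<le> w z j" by (rule w(1)[OF _ near_bary_le[OF z]])
qed (use w in auto)

text \<open>
  With at least three vertices, three jumps lead from anywhere to a neighbourhood of \<open>E\<^sub>0\<close>: first to
  whichever vertex is a likely target, then to a vertex different from that one and from \<open>E\<^sub>0\<close>, then
  to \<open>E\<^sub>0\<close>. The detour in the middle makes the number of jumps independent of the starting point, so
  that the tour through the other vertices begins at a fixed time.
\<close>

lemma contraction_higher_dim:
  assumes d: "2 \<le> CARD('n)"
    and q: "0 < prob {1 - \<delta>..}"
    and w: "\<And>z j. z \<in> orth_simplex \<Longrightarrow> bary z j \<le> \<delta> \<Longrightarrow> \<epsilon> \<le> w z j" "0 < \<epsilon>"
    and ab: "0 \<le> \<delta>" "\<delta> \<le> 1/2" "\<delta> \<le> a" "a < b" "b < 1"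
    and c: "0 < c" and dens: "\<And>B. B \<in> sets borel \<Longrightarrow> B \<subseteq> {a - \<delta>..b} \<Longrightarrow> c * measure lborel B \<le> prob B"
  shows "\<exists>m \<rho>. 0 < \<rho> \<and> \<rho> < 1 \<and> contracts m \<rho>"
proof -
  obtain js :: "'n option list" where js: "set js = - {None}" "distinct js"
    using finite_distinct_list[of "- {None :: 'n option}"] by auto
  define n where "n = length js"
  define q' where "q' = prob {1 - \<delta>..}"
  define \<beta> where "\<beta> f = (\<epsilon> * c / 2) ^ n * visits a b f js {None} 0" for f
  define K where "K = 1 / (CARD('n) + 1) * q' * (\<epsilon> * q' * (\<epsilon> * q'))"
  have K: "0 < K" using q w by (simp add: K_def q'_def)
  have minor: "K * \<beta> f \<le> (T ^^ (n + 3)) f z"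
    if f: "bounded_borel f" "\<And>z. 0 \<le> f z" and z: "z \<in> orth_simplex" for f z
  proof -
    define g where "g = (T ^^ n) f"
    have g: "bounded_borel ((T ^^ k) g)" "0 \<le> (T ^^ k) g y" for k y
      unfolding g_def using f by (auto intro!: bounded_borel_T_pow T_pow_nonneg)
    have \<beta>0: "0 \<le> \<beta> f"
      unfolding \<beta>_def using f w c by (intro mult_nonneg_nonneg visits_nonneg zero_le_power) auto
    \<comment> \<open>The tour started at \<open>y\<close> may be replaced by the tour started at \<open>E\<^sub>0\<close> itself, which is the zero
      vector: on \<open>{E\<^sub>0}\<close> alone any two points are proportional.\<close>
    have near0: "\<beta> f \<le> g y" if y: "y \<in> near \<delta> None" for y
    proof -
      have "(\<epsilon> * c / 2) ^ n * visits a b f js {None} y \<le> g y"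
        unfolding g_def n_def using f w c ab dens js y
        by (intro T_pow_ge_visits[where \<delta>=\<delta>]) (auto simp: near_def simp del: bary.simps)
      also have "visits a b f js {None} y = visits a b f js {None} 0"
        using ab js y
        by (intro visits_proportional[where c="bary y None" and \<delta>=\<delta>])
          (auto simp: near_def orth_simplex_def)
      finally show ?thesis by (simp add: \<beta>_def)
    qed
    have q': "q' \<le> prob {1 - \<delta>..}" "0 \<le> q'" "0 \<le> \<delta>" "\<delta> \<le> 1" and \<epsilon>: "0 \<le> \<epsilon>"
      using ab w by (auto simp: q'_def)
    have near1: "\<epsilon> * q' * \<beta> f \<le> T g y" if y: "y \<in> near \<delta> i" "None \<noteq> i" for y i
      using q' w(1) \<epsilon> g[of 0, simplified] \<beta>0 near0 y by (rule T_ge_other_vertex)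
    have near2: "\<epsilon> * q' * (\<epsilon> * q' * \<beta> f) \<le> T (T g) y" if y: "y \<in> near \<delta> i" for y i
    proof -
      have "card {None, i} < card (UNIV :: 'n option set)"
        using d card_insert_le_m1[of 2 "{i}" None] by (simp add: card_UNIV_option)
      then have "{None, i} \<noteq> (UNIV :: 'n option set)" by (metis less_irrefl)
      then obtain k where k: "k \<noteq> None" "k \<noteq> i" by blast
      have "0 \<le> \<epsilon> * q' * \<beta> f" using q' \<epsilon> \<beta>0 by simp
      with q' w(1) \<epsilon> g[of 1, simplified] show ?thesis
        using near1[OF _ k(1)[symmetric]] y k(2) by (rule T_ge_other_vertex)
    qed
    have "1 / (CARD('n) + 1) * q' * (\<epsilon> * q' * (\<epsilon> * q' * \<beta> f)) \<le> T (T (T g)) z"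
    proof (rule T_ge_anywhere[OF q' _ _ _ near2 z])
      show "bounded_borel (T (T g))" "\<And>z. 0 \<le> T (T g) z" using g[of 2] by (simp_all add: numeral_2_eq_2)
      show "0 \<le> \<epsilon> * q' * (\<epsilon> * q' * \<beta> f)" using q' \<epsilon> \<beta>0 by simp
    qed
    moreover have "T (T (T g)) = (T ^^ (n + 3)) f"
      by (simp add: g_def numeral_3_eq_3)
    ultimately show ?thesis by (simp add: K_def mult.assoc)
  qed
  have mass: "K * \<beta> f + K * \<beta> (\<lambda>z. 1 - f z) = K * ((\<epsilon> * c / 2) ^ n * (b - a) ^ n)"
    if "bounded_borel f" for f
    using visits_complement[OF that, of a b js "{None}" 0] ab
    by (simp add: \<beta>_def n_def flip: distrib_left)
  have pos: "0 < K * ((\<epsilon> * c / 2) ^ n * (b - a) ^ n)"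
    using K w c ab by simp
  show ?thesis
    using contraction_if_minorized[where \<Lambda>="\<lambda>f. K * \<beta> f", OF minor mass pos] by blast
qed

text \<open>
  On the segment there is no third vertex for a detour, and in general no fixed number of large jumps
  leads near \<open>E\<^sub>0\<close> from both endpoints. Instead the tours from \<open>E\<^sub>0\<close> to \<open>E\<^sub>1\<close> and from \<open>E\<^sub>1\<close> to \<open>E\<^sub>0\<close>, of one visit each,
  are compared: the share \<open>u\<close> of \<open>E\<^sub>1\<close> in the first and the share \<open>1 - u\<close> of \<open>E\<^sub>0\<close> in the second describe
  the same point. This is where the density near \<open>[1 - b, 1 - a]\<close> enters.
\<close>

lemma contraction_dim_one:
  assumes d: "CARD('n) = 1"
    and q: "0 < prob {1 - \<delta>..}"
    and w: "\<And>z j. z \<in> orth_simplex \<Longrightarrow> bary z j \<le> \<delta> \<Longrightarrow> \<epsilon> \<le> w z j" "0 < \<epsilon>"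
    and ab: "0 \<le> \<delta>" "\<delta> \<le> 1/2" "\<delta> \<le> a" "a < b" "b \<le> 1 - \<delta>" "0 < a" "b < 1"
    and c: "0 < c" and dens: "\<And>B. B \<in> sets borel \<Longrightarrow> B \<subseteq> {a - \<delta>..b} \<Longrightarrow> c * measure lborel B \<le> prob B"
    and dens': "\<And>B. B \<in> sets borel \<Longrightarrow> B \<subseteq> {1 - b - \<delta>..1 - a} \<Longrightarrow> c * measure lborel B \<le> prob B"
  shows "\<exists>m \<rho>. 0 < \<rho> \<and> \<rho> < 1 \<and> contracts m \<rho>"
proof -
  obtain i :: 'n where i: "UNIV = {i}" using d by (auto simp: card_1_singleton_iff)
  have U: "UNIV = {None, Some i}" "UNIV = {Some i, None}" using i by (auto simp: UNIV_option_conv)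
  define pt where "pt u = visit {None} (Some i) u 0" for u
  have 0: "(0 :: real ^ 'n) \<in> orth_simplex" by (simp add: orth_simplex_def)
  have pt0: "bary (pt u) (Some i) = u" "bary (pt u) None = 1 - u" if "u < 1" for u
    unfolding pt_def using that visit_between_two[of None "Some i" 0 u] U 0 by auto
  have pt_eqI: "y = pt u" if "u < 1" "bary y (Some i) = u" "bary y None = 1 - u" for y u
  proof (rule bary_eqI)
    fix l :: "'n option"
    have "l \<in> {None, Some i}" using U by auto
    then show "bary y l = bary (pt u) l" using pt0[OF that(1)] that by auto
  qed
  have [measurable]: "pt \<in> borel_measurable borel" unfolding pt_def by measurable
  define q' where "q' = prob {1 - \<delta>..}"
  define \<beta> where "\<beta> f = \<epsilon> * c / 2 * (\<integral>u. indicator {a..b} u * f (pt u) \<partial>lborel)" for f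
  define K where "K = 1 / (CARD('n) + 1) * q'"
  have K: "0 < K" using q by (simp add: K_def q'_def)
  have minor: "K * \<beta> f \<le> (T ^^ 2) f z"
    if f: "bounded_borel f" "\<And>z. 0 \<le> f z" and z: "z \<in> orth_simplex" for f z
  proof -
    have \<beta>0: "0 \<le> \<beta> f"
      unfolding \<beta>_def using f w c by (intro mult_nonneg_nonneg integral_nonneg_AE) auto
    have near: "\<beta> f \<le> T f y" if y: "y \<in> near \<delta> j" for y j
    proof -
      have yj: "1 - \<delta> \<le> bary y j" "0 < bary y j" "y \<in> orth_simplex"
        using y ab by (auto simp: near_def)
      consider "j = None" | "j = Some i" using U by auto
      then show ?thesis
      proof cases
        case 1
        have "\<beta> f = \<epsilon> * c / 2 * (\<integral>u. indicator {a..b} u * f (visit {None} (Some i) u y) \<partial>lborel)"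
          unfolding \<beta>_def
        proof (rule arg_cong[where f="\<lambda>v. \<epsilon> * c / 2 * v"], rule Bochner_Integration.integral_cong[OF refl])
          fix u
          have "pt u = visit {None} (Some i) u y" if "u \<in> {a..b}"
            using that ab 1 yj visit_between_two[of None "Some i" y u] U
            by (intro pt_eqI[symmetric]) auto
          then show "indicator {a..b} u * f (pt u) = indicator {a..b} u * f (visit {None} (Some i) u y)"
            by (auto simp: indicator_def)
        qed
        also have "\<dots> \<le> T f y"
          using f w ab c dens yj near_bary_le[OF y] 1
          by (intro T_ge_visit[where \<delta>=\<delta>]) (auto simp del: bary.simps)
        finally show ?thesis .
      next
        case 2
        let ?k = "\<lambda>v. indicator {1 - b..1 - a} v * f (visit {Some i} None v y)"
        have "(\<integral>v. ?k v \<partial>lborel) = (\<integral>u. ?k (1 + (-1) * u) \<partial>lborel)"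
          by (subst lborel_integral_real_affine[where c="-1" and t=1]) auto
        also have "\<dots> = (\<integral>u. indicator {a..b} u * f (pt u) \<partial>lborel)"
        proof (intro Bochner_Integration.integral_cong refl)
          fix u
          have "pt u = visit {Some i} None (1 - u) y" if "u \<in> {a..b}"
            using that ab 2 yj visit_between_two[of "Some i" None y "1 - u"] U
            by (intro pt_eqI[symmetric]) auto
          then show "?k (1 + (-1) * u) = indicator {a..b} u * f (pt u)"
            by (auto simp: indicator_def)
        qed
        finally have "\<beta> f = \<epsilon> * c / 2 * (\<integral>v. ?k v \<partial>lborel)" by (simp add: \<beta>_def)
        also have "\<dots> \<le> T f y"
          using f w ab c dens' yj near_bary_le[OF y] 2
          by (intro T_ge_visit[where \<delta>=\<delta>]) (auto simp del: bary.simps)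
        finally show ?thesis .
      qed
    qed
    have "1 / (CARD('n) + 1) * q' * \<beta> f \<le> T (T f) z"
      using near z \<beta>0 bounded_borel_T_pow[OF f(1), of 1] T_pow_nonneg[OF f, of 1] ab
      by (intro T_ge_anywhere[where \<delta>=\<delta>]) (auto simp: q'_def)
    then show ?thesis by (simp add: K_def numeral_2_eq_2)
  qed
  have mass: "K * \<beta> f + K * \<beta> (\<lambda>z. 1 - f z) = K * (\<epsilon> * c / 2 * (b - a))"
    if f: "bounded_borel f" for f
    using visits_complement[OF f, of a b "[Some i]" "{None}" 0] ab
    by (simp add: \<beta>_def pt_def flip: distrib_left)
  have pos: "0 < K * (\<epsilon> * c / 2 * (b - a))"
    using K w c ab by simp
  show ?thesis
    using contraction_if_minorized[where \<Lambda>="\<lambda>f. K * \<beta> f", OF minor mass pos] by blast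
qed

end

section \<open>Setwise limits of probability measures\<close>

lemma integral_finite_range:
  fixes g :: "'a::topological_space \<Rightarrow> real"
  assumes "finite_measure \<nu>" "sets \<nu> = sets borel" and g: "g \<in> borel_measurable borel" "finite (range g)"
  shows "(\<integral>x. g x \<partial>\<nu>) = (\<Sum>v\<in>range g. measure \<nu> (g -` {v}) * v)"
proof -
  interpret finite_measure \<nu> by fact
  have [simp]: "space \<nu> = UNIV" using sets_eq_imp_space_eq[OF assms(2)] by simp
  have s: "g -` {v} \<in> sets \<nu>" for v
    using measurable_sets[OF g(1), of "{v}"] by (simp add: assms(2))
  have "(\<integral>x. g x \<partial>\<nu>) = (\<integral>x. (\<Sum>v\<in>range g. indicator (g -` {v}) x * v) \<partial>\<nu>)"
  proof (intro Bochner_Integration.integral_cong refl)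
    fix x
    have "(\<Sum>v\<in>range g. indicator (g -` {v}) x * v) = (\<Sum>v\<in>range g. if v = g x then v else 0)"
      by (intro sum.cong) (auto simp: indicator_def)
    then show "g x = (\<Sum>v\<in>range g. indicator (g -` {v}) x * v)" using g(2) by simp
  qed
  also have "\<dots> = (\<Sum>v\<in>range g. (\<integral>x. indicator (g -` {v}) x * v \<partial>\<nu>))"
    using s by (intro Bochner_Integration.integral_sum integrable_mult_left integrable_real_indicator)
      (auto simp: emeasure_eq_measure)
  also have "\<dots> = (\<Sum>v\<in>range g. measure \<nu> (g -` {v}) * v)" using s by simp
  finally show ?thesis .
qed

text \<open>
  Setwise convergence yields convergence of integrals by approximating \<open>f\<close> uniformly with the
  function \<open>g\<close> that rounds its values down to multiples of \<open>e/4\<close> and so takes finitely many values.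
\<close>

lemma integral_tendsto_if_setwise:
  fixes f :: "'a::topological_space \<Rightarrow> real"
  assumes "\<And>n. prob_space (\<nu> n)" "\<And>n. sets (\<nu> n) = sets borel" "prob_space \<mu>" "sets \<mu> = sets borel"
    and lim: "\<And>A. A \<in> sets borel \<Longrightarrow> (\<lambda>n. measure (\<nu> n) A) \<longlonglongrightarrow> measure \<mu> A"
    and f: "bounded_borel f"
  shows "(\<lambda>n. \<integral>x. f x \<partial>\<nu> n) \<longlonglongrightarrow> (\<integral>x. f x \<partial>\<mu>)"
proof (rule LIMSEQ_I)
  fix e :: real assume e: "0 < e"
  obtain B where [measurable]: "f \<in> borel_measurable borel" and B: "\<And>z. \<bar>f z\<bar> \<le> B"
    using f by (rule bounded_borelE) blast
  define g where "g x = e / 4 * real_of_int \<lfloor>f x / (e / 4)\<rfloor>" for x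
  have g_meas: "g \<in> borel_measurable borel" unfolding g_def by measurable
  have fg: "\<bar>f x - g x\<bar> \<le> e / 4" for x
  proof -
    have "f x / (e / 4) - 1 \<le> real_of_int \<lfloor>f x / (e / 4)\<rfloor>" "real_of_int \<lfloor>f x / (e / 4)\<rfloor> \<le> f x / (e / 4)"
      by linarith+
    from this[THEN mult_left_mono, of "e / 4"] show ?thesis
      using e by (auto simp: g_def abs_le_iff right_diff_distrib)
  qed
  have fin: "finite (range g)"
  proof (rule finite_subset)
    show "range g \<subseteq> (\<lambda>k. e / 4 * real_of_int k) ` {\<lfloor>- B / (e / 4)\<rfloor>..\<lfloor>B / (e / 4)\<rfloor>}"
    proof (rule image_subsetI)
      fix x
      have "- B \<le> f x" "f x \<le> B" using B[of x] by auto
      then have "\<lfloor>f x / (e / 4)\<rfloor> \<in> {\<lfloor>- B / (e / 4)\<rfloor>..\<lfloor>B / (e / 4)\<rfloor>}"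
        using e unfolding atLeastAtMost_iff by (intro conjI floor_mono divide_right_mono) auto
      then show "g x \<in> (\<lambda>k. e / 4 * real_of_int k) ` {\<lfloor>- B / (e / 4)\<rfloor>..\<lfloor>B / (e / 4)\<rfloor>}"
        unfolding g_def by (rule imageI)
    qed
  qed simp
  have g_bounded: "bounded_borel g"
  proof (rule bounded_borelI[OF g_meas])
    show "\<bar>g x\<bar> \<le> B + e / 4" for x using B[of x] fg[of x] by linarith
  qed
  have close: "\<bar>(\<integral>x. f x \<partial>\<kappa>) - (\<integral>x. g x \<partial>\<kappa>)\<bar> \<le> e / 4"
    if "prob_space \<kappa>" "sets \<kappa> = sets borel" for \<kappa>
  proof -
    interpret prob_space \<kappa> by fact
    have id: "(\<lambda>x. x) \<in> borel_measurable \<kappa>" using that by (simp add: measurable_ident_sets)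
    have i: "integrable \<kappa> f" "integrable \<kappa> g"
      using integrable_bounded_borel[OF f id] integrable_bounded_borel[OF g_bounded id] by auto
    have "\<bar>\<integral>x. f x - g x \<partial>\<kappa>\<bar> \<le> (\<integral>x. \<bar>f x - g x\<bar> \<partial>\<kappa>)" by (rule integral_abs_bound)
    also have "\<dots> \<le> (\<integral>x. e / 4 \<partial>\<kappa>)"
      using i fg by (intro integral_mono) auto
    finally show ?thesis using i by (simp add: prob_space)
  qed
  have "(\<lambda>n. \<Sum>v\<in>range g. measure (\<nu> n) (g -` {v}) * v) \<longlonglongrightarrow> (\<Sum>v\<in>range g. measure \<mu> (g -` {v}) * v)"
  proof (intro tendsto_sum tendsto_mult tendsto_const lim)
    show "g -` {v} \<in> sets borel" for v using measurable_sets[OF g_meas, of "{v}"] by simp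
  qed
  then have "(\<lambda>n. \<integral>x. g x \<partial>\<nu> n) \<longlonglongrightarrow> (\<integral>x. g x \<partial>\<mu>)"
    using assms(1-4) g_meas fin by (simp add: integral_finite_range prob_space.finite_measure)
  from LIMSEQ_D[OF this, of "e / 4"] obtain n0 where
    n0: "\<And>n. n0 \<le> n \<Longrightarrow> norm ((\<integral>x. g x \<partial>\<nu> n) - (\<integral>x. g x \<partial>\<mu>)) < e / 4" using e by auto
  show "\<exists>n0. \<forall>n\<ge>n0. norm ((\<integral>x. f x \<partial>\<nu> n) - (\<integral>x. f x \<partial>\<mu>)) < e"
  proof (intro exI[of _ n0] allI impI)
    fix n assume "n0 \<le> n"
    with n0[of n] close[OF assms(1,2), of n] close[OF assms(3,4)]
    show "norm ((\<integral>x. f x \<partial>\<nu> n) - (\<integral>x. f x \<partial>\<mu>)) < e"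
      unfolding real_norm_def by argo
  qed
qed

text \<open>
  Uniformity over all Borel sets makes the setwise limit countably additive: if \<open>A\<^sub>i\<close> decreases to the
  empty set, then \<open>l (A\<^sub>i) \<le> \<nu>\<^sub>n (A\<^sub>i) + e\<close> for one \<open>n\<close> and all \<open>i\<close>, and the right-hand side tends to \<open>e\<close>.
\<close>

lemma setwise_limit_exists:
  fixes \<nu> :: "nat \<Rightarrow> 'a::topological_space measure"
  assumes ps: "\<And>n. prob_space (\<nu> n)" and sets: "\<And>n. sets (\<nu> n) = sets borel"
    and cauchy: "\<And>e. 0 < e \<Longrightarrow> \<exists>n0. \<forall>n\<ge>n0. \<forall>n'\<ge>n0. \<forall>A\<in>sets borel.
      \<bar>measure (\<nu> n) A - measure (\<nu> n') A\<bar> \<le> e"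
  obtains \<mu> where "prob_space \<mu>" "sets \<mu> = sets borel"
    "\<And>A. A \<in> sets borel \<Longrightarrow> (\<lambda>n. measure (\<nu> n) A) \<longlonglongrightarrow> measure \<mu> A"
proof -
  define l where "l A = lim (\<lambda>n. measure (\<nu> n) A)" for A
  have [simp]: "space (\<nu> n) = UNIV" for n using sets_eq_imp_space_eq[OF sets, of n] by simp
  have lim: "(\<lambda>n. measure (\<nu> n) A) \<longlonglongrightarrow> l A" if A: "A \<in> sets borel" for A
  proof -
    have "Cauchy (\<lambda>n. measure (\<nu> n) A)"
    proof (rule CauchyI)
      fix e :: real assume "0 < e"
      then obtain n0 where "\<forall>n\<ge>n0. \<forall>n'\<ge>n0. \<forall>A\<in>sets borel. \<bar>measure (\<nu> n) A - measure (\<nu> n') A\<bar> \<le> e / 2"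
        using cauchy[of "e / 2"] by auto
      then have "\<forall>n\<ge>n0. \<forall>n'\<ge>n0. norm (measure (\<nu> n) A - measure (\<nu> n') A) < e"
        using A \<open>0 < e\<close> by fastforce
      then show "\<exists>n0. \<forall>n\<ge>n0. \<forall>n'\<ge>n0. norm (measure (\<nu> n) A - measure (\<nu> n') A) < e" ..
    qed
    then show ?thesis unfolding l_def by (simp add: convergent_LIMSEQ_iff[symmetric] Cauchy_convergent)
  qed
  have unif: "\<exists>n. \<forall>A\<in>sets borel. l A \<le> measure (\<nu> n) A + e" if e: "0 < e" for e
  proof -
    obtain n0 where n0: "\<forall>n\<ge>n0. \<forall>n'\<ge>n0. \<forall>A\<in>sets borel. \<bar>measure (\<nu> n) A - measure (\<nu> n') A\<bar> \<le> e"
      using cauchy[OF e] by auto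
    have "l A \<le> measure (\<nu> n0) A + e" if A: "A \<in> sets borel" for A
    proof (rule LIMSEQ_le_const2[OF lim[OF A]], intro exI[of _ n0] allI impI)
      fix n assume "n0 \<le> n"
      then have "\<bar>measure (\<nu> n) A - measure (\<nu> n0) A\<bar> \<le> e" using n0 A by auto
      then show "measure (\<nu> n) A \<le> measure (\<nu> n0) A + e" by linarith
    qed
    then show ?thesis by blast
  qed
  have l_nonneg: "0 \<le> l A" if "A \<in> sets borel" for A
    by (rule LIMSEQ_le_const[OF lim[OF that]]) auto
  have "countably_additive (sets (borel :: 'a measure)) (\<lambda>A. ennreal (l A))"
  proof (rule sets.empty_continuous_imp_countably_additive)
    have "l {} = 0" by (simp add: l_def)
    then show "positive (sets (borel :: 'a measure)) (\<lambda>A. ennreal (l A))" by (simp add: positive_def)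
    show "additive (sets (borel :: 'a measure)) (\<lambda>A. ennreal (l A))"
      unfolding additive_def
    proof (intro ballI impI)
      fix A B :: "'a set" assume AB: "A \<in> sets borel" "B \<in> sets borel" "A \<inter> B = {}"
      have "measure (\<nu> n) (A \<union> B) = measure (\<nu> n) A + measure (\<nu> n) B" for n
      proof -
        interpret prob_space "\<nu> n" by (rule ps)
        show ?thesis using AB by (intro finite_measure_Union) (auto simp: sets)
      qed
      then have "(\<lambda>n. measure (\<nu> n) (A \<union> B)) \<longlonglongrightarrow> l A + l B"
        using AB by (simp add: tendsto_add lim)
      then have "l (A \<union> B) = l A + l B"
        using LIMSEQ_unique lim[of "A \<union> B"] AB by blast
      then show "ennreal (l (A \<union> B)) = ennreal (l A) + ennreal (l B)"
        using AB by (simp add: l_nonneg)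
    qed
    fix A :: "nat \<Rightarrow> 'a set"
    assume A: "range A \<subseteq> sets borel" "decseq A" "(\<Inter>i. A i) = {}"
    have "(\<lambda>i. l (A i)) \<longlonglongrightarrow> 0"
    proof (rule LIMSEQ_I)
      fix e :: real assume e: "0 < e"
      then obtain n where n: "\<forall>A\<in>sets borel. l A \<le> measure (\<nu> n) A + e / 2" using unif[of "e / 2"] by auto
      interpret prob_space "\<nu> n" by (rule ps)
      have "(\<lambda>i. measure (\<nu> n) (A i)) \<longlonglongrightarrow> measure (\<nu> n) (\<Inter>i. A i)"
        using A by (intro finite_Lim_measure_decseq) (auto simp: sets)
      then have "(\<lambda>i. measure (\<nu> n) (A i)) \<longlonglongrightarrow> 0" using A by simp
      from LIMSEQ_D[OF this, of "e / 2"] obtain i0 where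
        i0: "\<And>i. i0 \<le> i \<Longrightarrow> measure (\<nu> n) (A i) < e / 2" using e by auto
      show "\<exists>i0. \<forall>i\<ge>i0. norm (l (A i) - 0) < e"
      proof (intro exI[of _ i0] allI impI)
        fix i assume "i0 \<le> i"
        have "A i \<in> sets borel" using A by auto
        then show "norm (l (A i) - 0) < e" using n i0[OF \<open>i0 \<le> i\<close>] l_nonneg[of "A i"] by force
      qed
    qed
    then show "(\<lambda>i. ennreal (l (A i))) \<longlonglongrightarrow> 0"
      using tendsto_ennrealI by fastforce
  qed simp
  then have emeasure: "emeasure (measure_of UNIV (sets borel) (\<lambda>A. ennreal (l A))) A = ennreal (l A)"
    if "A \<in> sets borel" for A
    using that sets.sigma_algebra_axioms[of "borel :: 'a measure"]
    by (intro emeasure_measure_of_sigma) (auto simp: positive_def l_def)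
  let ?\<mu> = "measure_of UNIV (sets borel) (\<lambda>A. ennreal (l A)) :: 'a measure"
  have sets_mu: "sets ?\<mu> = sets borel"
    using sets.sigma_sets_eq[of "borel :: 'a measure"] by (simp add: sets_measure_of_conv)
  have measure: "measure ?\<mu> A = l A" if "A \<in> sets borel" for A
    using that by (simp add: measure_def emeasure l_nonneg)
  have "l UNIV = 1"
  proof -
    have "measure (\<nu> n) UNIV = 1" for n using prob_space.prob_space[OF ps, of n] by simp
    then show ?thesis by (simp add: l_def)
  qed
  then have "prob_space ?\<mu>"
    by (intro prob_spaceI) (simp add: emeasure space_measure_of_conv)
  then show ?thesis using that sets_mu measure lim by simp
qed

section \<open>Markov property and convergence\<close>

locale simplex_chain_kernel = simplex_chain M N \<xi> p Z \<xi>s \<Theta> + N: prob_space N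
  for M :: "'w measure" and N :: "'v measure" and \<xi> :: "'v \<Rightarrow> real"
    and p :: "real ^ 'n::finite \<Rightarrow> real ^ 'n" and Z :: "nat \<Rightarrow> 'w \<Rightarrow> real ^ 'n"
    and \<xi>s :: "nat \<Rightarrow> 'w \<Rightarrow> real" and \<Theta> :: "nat \<Rightarrow> 'w \<Rightarrow> real ^ 'n" +
  assumes p_measurable:
      "p \<in> restrict_space borel orth_simplex \<rightarrow>\<^sub>M restrict_space borel orth_simplex"
    and xi_measurable [measurable]: "\<xi> \<in> borel_measurable N"
    and xi_support: "AE x in N. \<xi> x \<in> {0..1}"
begin

definition jump_law :: "real measure"
  where "jump_law = distr N borel \<xi>"

text \<open>
  Outside the simplex \<open>p\<close> is arbitrary, even nonmeasurable; there its value is replaced by \<open>E\<^sub>0\<close>.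
\<close>

definition target_prob :: "real ^ 'n \<Rightarrow> 'n option \<Rightarrow> real"
  where "target_prob z = bary (if z \<in> orth_simplex then p z else 0)"

lemma p_in_simplex: "z \<in> orth_simplex \<Longrightarrow> p z \<in> orth_simplex"
  using measurable_space[OF p_measurable, of z] by (simp add: space_restrict_space)

sublocale kernel: vertex_kernel jump_law target_prob
proof (intro vertex_kernel.intro vertex_kernel_axioms.intro)
  show "prob_space jump_law" unfolding jump_law_def by (rule N.prob_space_distr) measurable
  show "sets jump_law = sets borel" by (simp add: jump_law_def)
  show "AE x in jump_law. x \<in> {0..1}"
    unfolding jump_law_def using xi_support by (subst AE_distr_iff) auto
  have "p \<in> restrict_space borel orth_simplex \<rightarrow>\<^sub>M borel"
    using p_measurable by (simp add: measurable_restrict_space2_iff)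
  then have [measurable]: "(\<lambda>z. if z \<in> orth_simplex then p z else 0) \<in> borel_measurable borel"
    by (subst (asm) measurable_restrict_space_iff[where c=0]) auto
  show "(\<lambda>z. target_prob z j) \<in> borel_measurable borel" for j
    unfolding target_prob_def by measurable
  have "(0 :: real ^ 'n) \<in> orth_simplex" by (simp add: orth_simplex_def)
  then show "0 \<le> target_prob z j" for z j
    using p_in_simplex by (auto simp: target_prob_def orth_simplex_iff_bary)
  show "(\<Sum>j\<in>UNIV. target_prob z j) = 1" for z
    unfolding target_prob_def by (rule sum_bary)
qed

lemma xis_measurable [measurable]: "\<xi>s n \<in> borel_measurable M"
  using copies_indep by (auto simp: indep_vars_def)

lemma Theta_measurable [measurable]: "\<Theta> n \<in> borel_measurable M"
  by (rule target_measurable)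

lemma Z_measurable [measurable]: "Z n \<in> borel_measurable M"
proof (induction n)
  case (Suc n)
  note [measurable] = Suc
  have "(\<lambda>\<omega>. (1 - \<xi>s n \<omega>) *\<^sub>R Z n \<omega> + \<xi>s n \<omega> *\<^sub>R \<Theta> n \<omega>) \<in> borel_measurable M" by measurable
  then show ?case by (subst measurable_cong[OF step])
qed (rule initial_measurable)

lemma Z_Suc_jump:
  assumes "\<omega> \<in> space M" "\<Theta> n \<omega> = vertex j"
  shows "Z (Suc n) \<omega> = jump j (\<xi>s n \<omega>) (Z n \<omega>)"
  using step[OF assms(1)] assms(2) by (simp add: jump_def)

lemma xis_unit: "AE \<omega> in M. \<xi>s n \<omega> \<in> {0..1}"
proof -
  have "AE x in distr M borel (\<xi>s n). x \<in> {0..1}"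
    unfolding copies_distr using kernel.mu_unit unfolding jump_law_def .
  then show ?thesis by (subst (asm) AE_distr_iff) auto
qed

lemma Z_in_simplex: "AE \<omega> in M. Z n \<omega> \<in> orth_simplex"
proof (induction n)
  case (Suc n)
  show ?case
    using Suc xis_unit[of n] AE_space
  proof eventually_elim
    case (elim \<omega>)
    obtain j where "\<Theta> n \<omega> = vertex j" using target_vertex[OF elim(3), of n] by auto
    with elim show ?case by (simp add: Z_Suc_jump jump_in_simplex)
  qed
qed (simp add: initial_in_simplex)

text \<open>
  The position \<open>Z\<^sub>n\<close> is measurable with respect to the past, of which the weight \<open>\<xi>\<^sub>n\<close> is independent;
  rectangles determine the joint law.
\<close>

lemma joint_law:
  "distr M borel (Z n) \<Otimes>\<^sub>M jump_law = distr M (borel \<Otimes>\<^sub>M borel) (\<lambda>\<omega>. (Z n \<omega>, \<xi>s n \<omega>))"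
proof (rule pair_measure_eqI)
  show "sigma_finite_measure (distr M borel (Z n))"
    by (intro prob_space_imp_sigma_finite prob_space_distr) measurable
  show "sigma_finite_measure jump_law" by (rule kernel.sigma_finite_measure_axioms)
  show "sets (distr M borel (Z n) \<Otimes>\<^sub>M jump_law)
      = sets (distr M (borel \<Otimes>\<^sub>M borel) (\<lambda>\<omega>. (Z n \<omega>, \<xi>s n \<omega>)))"
    by (simp add: kernel.sets_mu cong: sets_pair_measure_cong)
  fix A B assume "A \<in> sets (distr M borel (Z n))" "B \<in> sets jump_law"
  then have [measurable]: "A \<in> sets borel" "B \<in> sets borel" by (simp_all add: kernel.sets_mu)
  let ?past = "\<lambda>\<omega>. (\<lambda>k\<in>{..n}. Z k \<omega>, \<lambda>k\<in>{..<n}. (\<xi>s k \<omega>, \<Theta> k \<omega>))"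
  let ?P = "(\<Pi>\<^sub>M k\<in>{..n}. borel) \<Otimes>\<^sub>M (\<Pi>\<^sub>M k\<in>{..<n}. borel \<Otimes>\<^sub>M borel)
    :: ((nat \<Rightarrow> real ^ 'n) \<times> (nat \<Rightarrow> real \<times> (real ^ 'n))) measure"
  let ?F = "vimage_algebra (space M) ?past ?P"
  have past: "?past \<in> ?F \<rightarrow>\<^sub>M ?P"
    by (rule measurable_vimage_algebra1) (auto simp: space_pair_measure space_PiM PiE_def)
  have "(\<lambda>\<omega>. fst (?past \<omega>) n) \<in> ?F \<rightarrow>\<^sub>M borel"
    by (rule measurable_compose[OF measurable_compose[OF past measurable_fst]])
      (rule measurable_component_singleton, simp)
  then have "Z n \<in> ?F \<rightarrow>\<^sub>M borel" by simp
  from measurable_sets[OF this, of A] have ZA: "Z n -` A \<inter> space M \<in> sets ?F" by simp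
  have xB: "\<xi>s n -` B \<inter> space M \<in> sets (vimage_algebra (space M) (\<xi>s n) borel)"
    by (rule in_vimage_algebra) simp
  have "prob ((\<xi>s n -` B \<inter> space M) \<inter> (Z n -` A \<inter> space M))
      = prob (\<xi>s n -` B \<inter> space M) * prob (Z n -` A \<inter> space M)"
    by (rule indep_setD[OF copies_indep_past xB ZA])
  moreover have "(\<lambda>\<omega>. (Z n \<omega>, \<xi>s n \<omega>)) -` (A \<times> B) \<inter> space M
      = (\<xi>s n -` B \<inter> space M) \<inter> (Z n -` A \<inter> space M)" by auto
  moreover have "emeasure jump_law B = emeasure (distr M borel (\<xi>s n)) B"
    by (simp only: jump_law_def copies_distr)
  ultimately show "emeasure (distr M borel (Z n)) A * emeasure jump_law B
      = emeasure (distr M (borel \<Otimes>\<^sub>M borel) (\<lambda>\<omega>. (Z n \<omega>, \<xi>s n \<omega>))) (A \<times> B)"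
    by (simp add: emeasure_distr emeasure_eq_measure mult.commute flip: ennreal_mult)
qed

lemma abs_target_prob_mult_le:
  assumes "\<bar>b\<bar> \<le> B"
  shows "\<bar>target_prob z j * b\<bar> \<le> B"
proof -
  have "target_prob z j \<le> 1"
    using member_le_sum[of j UNIV "target_prob z"] kernel.w_nonneg[of z] kernel.w_sum[of z] by auto
  then have "\<bar>target_prob z j\<bar> * \<bar>b\<bar> \<le> 1 * B"
    using assms kernel.w_nonneg[of z j] by (intro mult_mono) auto
  then show ?thesis by (simp add: abs_mult)
qed

text \<open>
  The integrand is a function of \<open>(Z\<^sub>n, \<xi>\<^sub>n)\<close> times the indicator of a target. Conditioning on
  \<open>Z\<^sub>0, \<dots>, Z\<^sub>n, \<xi>\<^sub>n\<close> turns the indicator into \<open>p\<^sub>j(Z\<^sub>n)\<close>, and then Fubini applies to the product law.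
\<close>

lemma expectation_jump_to_target:
  assumes f: "bounded_borel f"
  shows "(\<integral>\<omega>. f (jump j (\<xi>s n \<omega>) (Z n \<omega>)) * indicator {\<omega> \<in> space M. \<Theta> n \<omega> = vertex j} \<omega> \<partial>M)
    = (\<integral>\<omega>. target_prob (Z n \<omega>) j * (\<integral>x. f (jump j x (Z n \<omega>)) \<partial>jump_law) \<partial>M)"
proof -
  obtain B where f_meas [measurable]: "f \<in> borel_measurable borel" and B: "\<And>z. \<bar>f z\<bar> \<le> B" "0 \<le> B"
    using f by (rule bounded_borelE) blast
  let ?A = "{\<omega> \<in> space M. \<Theta> n \<omega> = vertex j}"
  have A [measurable]: "?A \<in> sets M" by measurable
  let ?obs = "\<lambda>\<omega>. (\<lambda>k\<in>{..n}. Z k \<omega>, \<xi>s n \<omega>)"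
  let ?P = "(\<Pi>\<^sub>M k\<in>{..n}. borel) \<Otimes>\<^sub>M borel :: ((nat \<Rightarrow> real ^ 'n) \<times> real) measure"
  let ?F = "vimage_algebra (space M) ?obs ?P"
  have obs_M: "?obs \<in> M \<rightarrow>\<^sub>M ?P" by measurable
  have "subalgebra M ?F"
    unfolding subalgebra_def using sets_image_in_sets[OF refl obs_M] by simp
  then interpret F: finite_measure_subalgebra M ?F
    by unfold_locales
  have obs: "?obs \<in> ?F \<rightarrow>\<^sub>M ?P"
    by (rule measurable_vimage_algebra1) (auto simp: space_pair_measure space_PiM PiE_def)
  have "(\<lambda>\<omega>. fst (?obs \<omega>) n) \<in> ?F \<rightarrow>\<^sub>M borel"
    by (rule measurable_compose[OF measurable_compose[OF obs measurable_fst]])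
      (rule measurable_component_singleton, simp)
  then have [measurable]: "Z n \<in> ?F \<rightarrow>\<^sub>M borel" by simp
  have [measurable]: "\<xi>s n \<in> ?F \<rightarrow>\<^sub>M borel"
    using measurable_compose[OF obs measurable_snd] by simp
  have "(\<integral>\<omega>. f (jump j (\<xi>s n \<omega>) (Z n \<omega>)) * indicator ?A \<omega> \<partial>M)
      = (\<integral>\<omega>. f (jump j (\<xi>s n \<omega>) (Z n \<omega>)) * real_cond_exp M ?F (indicator ?A) \<omega> \<partial>M)"
  proof (rule F.real_cond_exp_intg(2)[symmetric])
    show "(\<lambda>\<omega>. f (jump j (\<xi>s n \<omega>) (Z n \<omega>))) \<in> borel_measurable ?F" by measurable
    show "integrable M (\<lambda>\<omega>. f (jump j (\<xi>s n \<omega>) (Z n \<omega>)) * indicator ?A \<omega>)"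
      using B by (intro integrable_const_bound[where B=B]) (auto simp: indicator_def)
  qed measurable
  also have "\<dots> = (\<integral>\<omega>. target_prob (Z n \<omega>) j * f (jump j (\<xi>s n \<omega>) (Z n \<omega>)) \<partial>M)"
  proof (rule integral_cong_AE)
    show "AE \<omega> in M. f (jump j (\<xi>s n \<omega>) (Z n \<omega>)) * real_cond_exp M ?F (indicator ?A) \<omega>
        = target_prob (Z n \<omega>) j * f (jump j (\<xi>s n \<omega>) (Z n \<omega>))"
      using target_cond_prob[of n j] Z_in_simplex[of n]
      by eventually_elim (simp add: target_prob_def)
  qed measurable
  also have "\<dots> = (\<integral>(z, x). target_prob z j * f (jump j x z)
      \<partial>distr M (borel \<Otimes>\<^sub>M borel) (\<lambda>\<omega>. (Z n \<omega>, \<xi>s n \<omega>)))"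
    by (subst integral_distr) auto
  also have "\<dots> = (\<integral>(z, x). target_prob z j * f (jump j x z) \<partial>(distr M borel (Z n) \<Otimes>\<^sub>M jump_law))"
    by (simp only: joint_law)
  also have "\<dots> = (\<integral>z. (\<integral>x. target_prob z j * f (jump j x z) \<partial>jump_law) \<partial>distr M borel (Z n))"
  proof -
    interpret Zn: prob_space "distr M borel (Z n)" by (rule prob_space_distr) measurable
    interpret pair_prob_space "distr M borel (Z n)" jump_law ..
    have "integrable (distr M borel (Z n) \<Otimes>\<^sub>M jump_law) (\<lambda>(z, x). target_prob z j * f (jump j x z))"
    proof (rule P.integrable_const_bound[where B=B])
      show "AE y in distr M borel (Z n) \<Otimes>\<^sub>M jump_law.
          norm (case y of (z, x) \<Rightarrow> target_prob z j * f (jump j x z)) \<le> B"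
        using B by (auto intro!: abs_target_prob_mult_le AE_I2)
    qed measurable
    from integral_fst'[OF this] show ?thesis by simp
  qed
  also have "\<dots> = (\<integral>\<omega>. target_prob (Z n \<omega>) j * (\<integral>x. f (jump j x (Z n \<omega>)) \<partial>jump_law) \<partial>M)"
  proof (subst integral_distr)
    have "(\<lambda>z. \<integral>x. target_prob z j * f (jump j x z) \<partial>jump_law) \<in> borel_measurable borel"
      by (rule kernel.borel_measurable_lebesgue_integral) measurable
    then show "(\<lambda>z. \<integral>x. target_prob z j * f (jump j x z) \<partial>jump_law) \<in> borel_measurable borel" .
  qed simp_all
  finally show ?thesis .
qed

lemma expectation_step:
  assumes f: "bounded_borel f"
  shows "expectation (\<lambda>\<omega>. f (Z (Suc n) \<omega>)) = expectation (\<lambda>\<omega>. kernel.T f (Z n \<omega>))"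
proof -
  obtain B where f_meas [measurable]: "f \<in> borel_measurable borel" and B: "\<And>z. \<bar>f z\<bar> \<le> B" "0 \<le> B"
    using f by (rule bounded_borelE) blast
  let ?g = "\<lambda>j \<omega>. f (jump j (\<xi>s n \<omega>) (Z n \<omega>)) * indicator {\<omega> \<in> space M. \<Theta> n \<omega> = vertex j} \<omega>"
  have "expectation (\<lambda>\<omega>. f (Z (Suc n) \<omega>)) = (\<integral>\<omega>. (\<Sum>j\<in>UNIV. ?g j \<omega>) \<partial>M)"
  proof (rule Bochner_Integration.integral_cong[OF refl])
    fix \<omega> assume \<omega>: "\<omega> \<in> space M"
    obtain i where i: "\<Theta> n \<omega> = vertex i" using target_vertex[OF \<omega>, of n] by auto
    have "(\<Sum>j\<in>UNIV. ?g j \<omega>) = (\<Sum>j\<in>UNIV. if j = i then f (Z (Suc n) \<omega>) else 0)"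
      using \<omega> i by (intro sum.cong) (auto simp: Z_Suc_jump indicator_def dest: injD[OF inj_vertex])
    then show "f (Z (Suc n) \<omega>) = (\<Sum>j\<in>UNIV. ?g j \<omega>)" by simp
  qed
  also have "\<dots> = (\<Sum>j\<in>UNIV. (\<integral>\<omega>. ?g j \<omega> \<partial>M))"
    using B by (intro Bochner_Integration.integral_sum integrable_const_bound[where B=B])
      (auto simp: indicator_def)
  also have "\<dots> = (\<Sum>j\<in>UNIV. \<integral>\<omega>. target_prob (Z n \<omega>) j * (\<integral>x. f (jump j x (Z n \<omega>)) \<partial>jump_law) \<partial>M)"
    by (simp only: expectation_jump_to_target[OF f])
  also have "\<dots> = expectation (\<lambda>\<omega>. kernel.T f (Z n \<omega>))"
    unfolding kernel.T_def
  proof (rule Bochner_Integration.integral_sum[symmetric])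
    fix j
    have m: "(\<lambda>z. \<integral>x. f (jump j x z) \<partial>jump_law) \<in> borel_measurable borel"
      by (rule kernel.borel_measurable_lebesgue_integral) measurable
    show "integrable M (\<lambda>\<omega>. target_prob (Z n \<omega>) j * (\<integral>x. f (jump j x (Z n \<omega>)) \<partial>jump_law))"
    proof (rule integrable_const_bound[where B=B])
      have "\<bar>\<integral>x. f (jump j x z) \<partial>jump_law\<bar> \<le> B" for z
      proof -
        have "\<bar>\<integral>x. f (jump j x z) \<partial>jump_law\<bar> \<le> (\<integral>x. \<bar>f (jump j x z)\<bar> \<partial>jump_law)"
          by (rule integral_abs_bound)
        also have "\<dots> \<le> (\<integral>x. B \<partial>jump_law)"
          using B kernel.integrable_jump[OF f] by (intro integral_mono) auto
        finally show ?thesis by (simp add: kernel.prob_space)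
      qed
      then show "AE \<omega> in M. norm (target_prob (Z n \<omega>) j * (\<integral>x. f (jump j x (Z n \<omega>)) \<partial>jump_law)) \<le> B"
        by (auto intro!: abs_target_prob_mult_le AE_I2)
      show "(\<lambda>\<omega>. target_prob (Z n \<omega>) j * (\<integral>x. f (jump j x (Z n \<omega>)) \<partial>jump_law)) \<in> borel_measurable M"
        using measurable_compose[OF Z_measurable m] by measurable
    qed
  qed
  finally show ?thesis .
qed

lemma expectation_iterate:
  "bounded_borel f \<Longrightarrow> expectation (\<lambda>\<omega>. f (Z (n + k) \<omega>)) = expectation (\<lambda>\<omega>. (kernel.T ^^ k) f (Z n \<omega>))"
proof (induction k arbitrary: f)
  case (Suc k)
  have "expectation (\<lambda>\<omega>. f (Z (n + Suc k) \<omega>)) = expectation (\<lambda>\<omega>. kernel.T f (Z (n + k) \<omega>))"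
    using expectation_step[OF Suc.prems, of "n + k"] by simp
  also have "\<dots> = expectation (\<lambda>\<omega>. (kernel.T ^^ k) (kernel.T f) (Z n \<omega>))"
    by (rule Suc.IH[OF kernel.bounded_borel_T[OF Suc.prems]])
  finally show ?case by (simp add: funpow_swap1)
qed simp

text \<open>
  For \<open>n \<ge> m k\<close> the probability of \<open>Z\<^sub>n \<in> A\<close> is the mean, over the law of \<open>Z\<^sub>n\<^sub>-\<^sub>m\<^sub>k\<close>, of \<open>T\<^sup>m\<^sup>k\<close> applied to the
  indicator of \<open>A\<close>, and this function has oscillation at most \<open>\<rho>\<^sup>k\<close>. So the laws form
  a Cauchy sequence uniformly over all Borel sets.
\<close>

lemma converges_if_contracts:
  assumes contr: "kernel.contracts m \<rho>" and \<rho>: "0 < \<rho>" "\<rho> < 1"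
  shows "converges_in_distribution M Z"
proof -
  define \<nu> where "\<nu> n = distr M borel (Z n)" for n
  have ps: "prob_space (\<nu> n)" for n unfolding \<nu>_def by (rule prob_space_distr) measurable
  have sets: "sets (\<nu> n) = sets borel" for n by (simp add: \<nu>_def)
  have close: "measure (\<nu> n) A - measure (\<nu> n') A \<le> \<rho> ^ k"
    if n: "m * k \<le> n" "m * k \<le> n'" and A [measurable]: "A \<in> sets borel" for n n' k A
  proof -
    let ?f = "indicator A :: real ^ 'n \<Rightarrow> real"
    let ?g = "(kernel.T ^^ (m * k)) ?f"
    have f: "bounded_borel ?f" by (intro bounded_borelI[where B=1]) (auto simp: indicator_def)
    have g: "bounded_borel ?g" by (rule kernel.bounded_borel_T_pow[OF f])
    have eq: "measure (\<nu> l) A = expectation (\<lambda>\<omega>. ?g (Z (l - m * k) \<omega>))" if "m * k \<le> l" for l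
    proof -
      have "measure (\<nu> l) A = (\<integral>z. ?f z \<partial>\<nu> l)" by (simp add: \<nu>_def)
      also have "\<dots> = expectation (\<lambda>\<omega>. ?f (Z l \<omega>))" unfolding \<nu>_def by (subst integral_distr) auto
      also have "\<dots> = expectation (\<lambda>\<omega>. ?g (Z (l - m * k) \<omega>))"
        using expectation_iterate[OF f, of "l - m * k" "m * k"] that by simp
      finally show ?thesis .
    qed
    have osc: "?g z - ?g z' \<le> \<rho> ^ k" if "z \<in> orth_simplex" "z' \<in> orth_simplex" for z z'
      using that by (intro kernel.oscillation_decay[OF contr \<rho>(1) f]) (auto simp: indicator_def)
    have int: "integrable M (\<lambda>\<omega>. ?g (Z l \<omega>))" for l
      by (rule integrable_bounded_borel[OF g]) measurable
    have upper: "expectation (\<lambda>\<omega>. ?g (Z l \<omega>)) \<le> ?g z + \<rho> ^ k" if z: "z \<in> orth_simplex" for z l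
    proof -
      have "expectation (\<lambda>\<omega>. ?g (Z l \<omega>)) \<le> expectation (\<lambda>_. ?g z + \<rho> ^ k)"
      proof (rule integral_mono_AE[OF int])
        show "AE \<omega> in M. ?g (Z l \<omega>) \<le> ?g z + \<rho> ^ k"
          using Z_in_simplex[of l] by eventually_elim (use osc z in \<open>auto simp: diff_le_eq add.commute\<close>)
      qed simp
      then show ?thesis by (simp add: prob_space)
    qed
    have "expectation (\<lambda>_. expectation (\<lambda>\<omega>. ?g (Z (n - m * k) \<omega>)) - \<rho> ^ k)
        \<le> expectation (\<lambda>\<omega>. ?g (Z (n' - m * k) \<omega>))"
    proof (rule integral_mono_AE[OF _ int])
      show "AE \<omega> in M. expectation (\<lambda>\<omega>. ?g (Z (n - m * k) \<omega>)) - \<rho> ^ k \<le> ?g (Z (n' - m * k) \<omega>)"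
        using Z_in_simplex[of "n' - m * k"]
        by eventually_elim (use upper in \<open>auto simp: diff_le_eq\<close>)
    qed simp
    then show ?thesis using n by (simp add: eq prob_space)
  qed
  have cauchy: "\<exists>n0. \<forall>n\<ge>n0. \<forall>n'\<ge>n0. \<forall>A\<in>sets borel. \<bar>measure (\<nu> n) A - measure (\<nu> n') A\<bar> \<le> e"
    if e: "0 < e" for e
  proof -
    obtain k where k: "\<rho> ^ k < e" using real_arch_pow_inv[OF e \<rho>(2)] by auto
    show ?thesis
    proof (intro exI[of _ "m * k"] allI impI ballI)
      fix n n' A assume "m * k \<le> n" "m * k \<le> n'" "A \<in> sets (borel :: (real ^ 'n) measure)"
      with close[of k n n' A] close[of k n' n A] k
      show "\<bar>measure (\<nu> n) A - measure (\<nu> n') A\<bar> \<le> e" by linarith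
    qed
  qed
  obtain \<mu> where \<mu>: "prob_space \<mu>" "sets \<mu> = sets borel"
    "\<And>A. A \<in> sets borel \<Longrightarrow> (\<lambda>n. measure (\<nu> n) A) \<longlonglongrightarrow> measure \<mu> A"
    using setwise_limit_exists[OF ps sets cauchy] by blast
  have "(\<lambda>n. \<integral>\<omega>. f (Z n \<omega>) \<partial>M) \<longlonglongrightarrow> (\<integral>x. f x \<partial>\<mu>)"
    if f: "continuous_on UNIV f" "bounded (range f)" for f :: "real ^ 'n \<Rightarrow> real"
  proof -
    have "f \<in> borel_measurable borel" using f(1) by (rule borel_measurable_continuous_onI)
    moreover obtain B where "\<And>z. \<bar>f z\<bar> \<le> B" using f(2) by (auto simp: bounded_iff)
    ultimately have f: "f \<in> borel_measurable borel" "bounded_borel f" by (auto intro: bounded_borelI)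
    have "(\<integral>x. f x \<partial>\<nu> n) = (\<integral>\<omega>. f (Z n \<omega>) \<partial>M)" for n
      unfolding \<nu>_def using f by (subst integral_distr) auto
    with integral_tendsto_if_setwise[OF ps sets \<mu> f(2)] show ?thesis by simp
  qed
  with \<mu> show ?thesis unfolding converges_in_distribution_def by blast
qed

end

section \<open>The convergence theorem\<close>

theorem theorem2p4:
  fixes M :: "'w measure"
    and N :: "'v measure"
    and \<xi> :: "'v \<Rightarrow> real"
    and p :: "real ^ 'n \<Rightarrow> real ^ 'n"
    and Z :: "nat \<Rightarrow> 'w \<Rightarrow> real ^ 'n"
    and \<xi>s :: "nat \<Rightarrow> 'w \<Rightarrow> real"
    and \<Theta> :: "nat \<Rightarrow> 'w \<Rightarrow> real ^ 'n"
    and \<delta> s t :: real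
  assumes p_measurable:
      "p \<in> restrict_space borel orth_simplex \<rightarrow>\<^sub>M restrict_space borel orth_simplex"
    and N: "prob_space N"
    and xi_measurable: "\<xi> \<in> borel_measurable N"
    and xi_support: "AE x in N. \<xi> x \<in> {0..1}"
    and chain: "simplex_chain M N \<xi> p Z \<xi>s \<Theta>"
    and delta: "\<delta> \<in> {0<..<1 / 2 ^ CARD('n)}"
    and s: "s \<in> {root CARD('n) \<delta> <..< 1 - root CARD('n) \<delta>}"
    and t: "t \<in> {root CARD('n) \<delta> <..< 1 - root CARD('n) \<delta>}"
    and s_less_t: "s < t"
    and cond_i: "\<P>(x in N. \<xi> x < 1 - \<delta>) < 1"
    and cond_ii: "\<exists>\<epsilon>>0. \<forall>J :: 'n option set. 1 \<le> card J \<and> card J \<le> CARD('n) \<longrightarrow>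
        (INF z\<in>{z \<in> orth_simplex. (\<Sum>j\<in>J. bary z j) \<le> \<delta>}. \<Sum>j\<in>J. bary (p z) j) \<ge> \<epsilon>"
    and cond_iii: "\<exists>c>0. \<forall>B \<in> sets borel.
        B \<subseteq> {s * (1 - t) ^ (CARD('n) - 1) - \<delta> .. t} \<union> {(1 - t) ^ CARD('n) - \<delta> .. 1 - s} \<longrightarrow>
        \<P>(x in N. \<xi> x \<in> B) \<ge> c * measure (restrict_space lborel {0..1}) B"
  shows "converges_in_distribution M Z"
proof -
  interpret chain: simplex_chain M N \<xi> p Z \<xi>s \<Theta> by (rule chain)
  interpret N: prob_space N by (rule N)
  interpret simplex_chain_kernel M N \<xi> p Z \<xi>s \<Theta>
    using p_measurable xi_measurable xi_support by unfold_locales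
  let ?d = "CARD('n)"
  note [measurable] = xi_measurable

  have d: "0 < ?d" by simp
  have \<delta>0: "0 < \<delta>" using delta by simp
  have pow_half: "(1/2) ^ ?d \<le> (1/2 :: real) ^ 1" using d by (intro power_decreasing) auto
  moreover have "\<delta> < (1/2) ^ ?d" using delta by (simp add: power_one_over)
  ultimately have \<delta>_half: "\<delta> \<le> 1/2" by simp
  have \<delta>_root: "\<delta> \<le> root ?d \<delta>"
  proof -
    have "\<delta> ^ ?d \<le> \<delta> ^ 1" using d \<delta>0 \<delta>_half by (intro power_decreasing) auto
    then have "root ?d (\<delta> ^ ?d) \<le> root ?d \<delta>" using d by simp
    then show ?thesis using d \<delta>0 by (simp add: real_root_power_cancel)
  qed
  have st: "\<delta> < s" "t < 1 - \<delta>" "0 < s" "t < 1" using s t \<delta>_root \<delta>0 by auto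

  obtain \<epsilon> where \<epsilon>: "0 < \<epsilon>" and J: "\<And>J :: 'n option set. 1 \<le> card J \<Longrightarrow> card J \<le> ?d \<Longrightarrow>
      \<epsilon> \<le> (INF z\<in>{z \<in> orth_simplex. (\<Sum>j\<in>J. bary z j) \<le> \<delta>}. \<Sum>j\<in>J. bary (p z) j)"
    using cond_ii by blast
  \<comment> \<open>For \<open>J = {j}\<close> the infimum bounds \<open>p\<^sub>j\<close> by itself, so that every single vertex with a small
    coordinate is a likely target.\<close>
  have w: "\<epsilon> \<le> target_prob z j" if z: "z \<in> orth_simplex" "bary z j \<le> \<delta>" for z j
  proof -
    have "\<epsilon> \<le> (INF z\<in>{z \<in> orth_simplex. bary z j \<le> \<delta>}. bary (p z) j)"
      using J[of "{j}"] d by simp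
    also have "\<dots> \<le> bary (p z) j"
    proof (rule cINF_lower)
      show "bdd_below ((\<lambda>z. bary (p z) j) ` {z \<in> orth_simplex. bary z j \<le> \<delta>})"
        using p_in_simplex by (intro bdd_belowI[of _ 0]) (auto simp: orth_simplex_iff_bary)
    qed (use z in simp)
    finally show ?thesis using z by (simp add: target_prob_def)
  qed

  have jump_law_measure: "measure jump_law B = \<P>(x in N. \<xi> x \<in> B)" if "B \<in> sets borel" for B
    unfolding jump_law_def using that
    by (subst measure_distr) (auto intro!: arg_cong[where f="measure N"])
  have "measure jump_law {..<1 - \<delta>} < 1" using cond_i by (simp add: jump_law_measure)
  then have q: "0 < measure jump_law {1 - \<delta>..}"
    using kernel.prob_compl[of "{..<1 - \<delta>}"]
    by (simp add: kernel.sets_mu jump_law_def Compl_eq_Diff_UNIV[symmetric])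

  obtain c where c: "0 < c" and dens: "\<And>B. B \<in> sets borel \<Longrightarrow>
      B \<subseteq> {s * (1 - t) ^ (?d - 1) - \<delta> .. t} \<union> {(1 - t) ^ ?d - \<delta> .. 1 - s} \<Longrightarrow>
      c * measure (restrict_space lborel {0..1}) B \<le> \<P>(x in N. \<xi> x \<in> B)"
    using cond_iii by blast
  have dens': "c * measure lborel B \<le> measure jump_law B"
    if "B \<in> sets borel" "B \<subseteq> {0..1}"
      "B \<subseteq> {s * (1 - t) ^ (?d - 1) - \<delta> .. t} \<union> {(1 - t) ^ ?d - \<delta> .. 1 - s}" for B
  proof -
    have "measure (restrict_space lborel {0..1}) B = measure lborel B"
      using that by (intro measure_restrict_space) auto
    then show ?thesis using dens[OF that(1,3)] that(1) by (simp add: jump_law_measure)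
  qed
  have dens_s: "c * measure lborel B \<le> measure jump_law B"
    if B: "B \<in> sets borel" "B \<subseteq> {s - \<delta>..t}" for B
  proof (rule dens'[OF B(1)])
    have "s * (1 - t) ^ (?d - 1) \<le> s * 1"
      using st s_less_t by (intro mult_left_mono power_le_one) auto
    then show "B \<subseteq> {s * (1 - t) ^ (?d - 1) - \<delta> .. t} \<union> {(1 - t) ^ ?d - \<delta> .. 1 - s}"
      using B(2) by auto
    show "B \<subseteq> {0..1}" using B(2) st by auto
  qed
  have "\<exists>m \<rho>. 0 < \<rho> \<and> \<rho> < 1 \<and> kernel.contracts m \<rho>"
  proof (cases "?d = 1")
    case True
    have dens_t: "c * measure lborel B \<le> measure jump_law B"
      if B: "B \<in> sets borel" "B \<subseteq> {1 - t - \<delta>..1 - s}" for B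
    proof (rule dens'[OF B(1)])
      show "B \<subseteq> {s * (1 - t) ^ (?d - 1) - \<delta> .. t} \<union> {(1 - t) ^ ?d - \<delta> .. 1 - s}"
        unfolding True using B(2) by auto
      show "B \<subseteq> {0..1}" using B(2) st by auto
    qed
    show ?thesis
      using st s_less_t \<delta>0 \<delta>_half c \<epsilon> q w dens_s dens_t
      by (intro kernel.contraction_dim_one[OF True, where \<delta>=\<delta> and \<epsilon>=\<epsilon> and a=s and b=t and c=c]) auto
  next
    case False
    then have "2 \<le> ?d" using d by linarith
    then show ?thesis
      using st s_less_t \<delta>0 \<delta>_half c \<epsilon> q w dens_s
      by (intro kernel.contraction_higher_dim[where \<delta>=\<delta> and \<epsilon>=\<epsilon> and a=s and b=t and c=c]) auto
  qed
  then show ?thesis using converges_if_contracts by blast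
qed

end
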